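(* Let $t\ge 1$ be a fixed odd integer. In the insertion-only streaming model, any (randomized, single-pass) algorithm that can distinguish whether a planar graph on $4n+2$ vertices is bipartite or is $\frac{1}{4t+2}$-far from being bipartite must use $\Omega(n^{1-1/t})$ bits of space.
   Context: In the insertion-only streaming model the input graph is given as a stream of edge insertions and no deletions. The algorithm is randomized and required to succeed with constant probability. A graph with $m$ edges is $\delta$-far from being bipartite if one has to delete at least $\delta m$ edges to obtain a bipartite graph. *)

theory Defs
  imports "HOL-Probability.Probability"
begin

definition simple_graph :: "'a set \<Rightarrow> 'a set set \<Rightarrow> bool" where
  "simple_graph V E \<longleftrightarrow> finite V \<and> (\<forall>e\<in>E. e \<subseteq> V \<and> card e = 2)"

text \<open>
  Existence of a drawing without crossings: distinct points for the vertices, and for every edge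
  a simple arc joining its end points that avoids all other vertices and meets the arcs of the
  other edges only in common end points.
\<close>

definition planar :: "'a set \<Rightarrow> 'a set set \<Rightarrow> bool" where
  "planar V E \<longleftrightarrow>
     (\<exists>(pos :: 'a \<Rightarrow> real ^ 2) (\<gamma> :: 'a set \<Rightarrow> real \<Rightarrow> real ^ 2).
        inj_on pos V \<and>
        (\<forall>e\<in>E. arc (\<gamma> e) \<and> {pathstart (\<gamma> e), pathfinish (\<gamma> e)} = pos ` e \<and>
               path_image (\<gamma> e) \<inter> pos ` V = pos ` e) \<and>
        (\<forall>e\<in>E. \<forall>f\<in>E. e \<noteq> f \<longrightarrow> path_image (\<gamma> e) \<inter> path_image (\<gamma> f) = pos ` (e \<inter> f)))"

definition bipartite :: "'a set \<Rightarrow> 'a set set \<Rightarrow> bool" where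
  "bipartite V E \<longleftrightarrow>
     (\<exists>X Y. X \<union> Y = V \<and> X \<inter> Y = {} \<and> (\<forall>e\<in>E. \<exists>x\<in>X. \<exists>y\<in>Y. e = {x, y}))"

definition far_from_bipartite :: "real \<Rightarrow> 'a set \<Rightarrow> 'a set set \<Rightarrow> bool" where
  "far_from_bipartite \<delta> V E \<longleftrightarrow>
     (\<forall>F\<subseteq>E. bipartite V (E - F) \<longrightarrow> \<delta> * real (card E) \<le> real (card F))"

text \<open>
  The memory content is a bit string. Every step may use fresh random bits, which are free unless
  they are kept in memory. There is no restriction on computability or running time.
\<close>

record stream_alg =
  init :: "bool list pmf"
  update :: "bool list \<Rightarrow> nat set \<Rightarrow> bool list pmf"
  answer :: "bool list \<Rightarrow> bool pmf"

definition run :: "stream_alg \<Rightarrow> nat set list \<Rightarrow> bool list pmf" where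
  "run A \<sigma> = foldl (\<lambda>D e. bind_pmf D (\<lambda>m. update A m e)) (init A) \<sigma>"

definition outcome :: "stream_alg \<Rightarrow> nat set list \<Rightarrow> bool pmf" where
  "outcome A \<sigma> = bind_pmf (run A \<sigma>) (answer A)"

text \<open>Worst case over the inputs, the coin tosses and the moments between two insertions.\<close>

definition uses_space :: "stream_alg \<Rightarrow> nat set list set \<Rightarrow> nat \<Rightarrow> bool" where
  "uses_space A I s \<longleftrightarrow>
     (\<forall>\<sigma>\<in>I. \<forall>k\<le>length \<sigma>. \<forall>m\<in>set_pmf (run A (take k \<sigma>)). length m \<le> s)"

definition planar_streams :: "nat \<Rightarrow> nat set list set" where
  "planar_streams N =
     {\<sigma>. distinct \<sigma> \<and> simple_graph {..<N} (set \<sigma>) \<and> planar {..<N} (set \<sigma>)}"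

text \<open>
  The graph without edges is bipartite and also, formally, \<open>\<delta>\<close>-far from being bipartite. It is
  counted as bipartite only: otherwise no algorithm could meet the specification below. For graphs
  with an edge and \<open>\<delta> > 0\<close>, being \<open>\<delta>\<close>-far already excludes being bipartite.
\<close>

definition yes_streams :: "nat \<Rightarrow> nat set list set" where
  "yes_streams N = {\<sigma> \<in> planar_streams N. bipartite {..<N} (set \<sigma>)}"

definition no_streams :: "real \<Rightarrow> nat \<Rightarrow> nat set list set" where
  "no_streams \<delta> N =
     {\<sigma> \<in> planar_streams N. far_from_bipartite \<delta> {..<N} (set \<sigma>) \<and> \<not> bipartite {..<N} (set \<sigma>)}"

definition distinguishes :: "real \<Rightarrow> stream_alg \<Rightarrow> real \<Rightarrow> nat \<Rightarrow> bool" where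
  "distinguishes p A \<delta> N \<longleftrightarrow>
     (\<forall>\<sigma>\<in>yes_streams N. pmf (outcome A \<sigma>) True \<ge> p) \<and>
     (\<forall>\<sigma>\<in>no_streams \<delta> N. pmf (outcome A \<sigma>) False \<ge> p)"

end

theory Submission
  imports Defs
begin

text \<open>
  Let \<open>k = 2t\<close>, let \<open>g\<close> be even and \<open>N = kg\<close>. A stream starts with gadgets that encode \<open>N\<close> hidden bits \<open>X\<close>:
  bit \<open>i\<close> decides whether two parallel edges between \<open>upper i\<close> and \<open>lower i\<close> are crossed. It continues
  with edges that thread the gadgets, in blocks of \<open>k\<close> given by a permutation \<open>p\<close>, into double
  strands; block \<open>j\<close> is closed up with a twist if \<open>j \<in> W\<close>. If \<open>W\<close> is the set of blocks of odd parity, then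
  every block consists of two odd cycles of length \<open>2k + 1\<close>; if it is the complement, then every
  block is a single cycle of length \<open>4k + 2\<close>. So the memory after the first part is a one-way message
  from which the two values of \<open>W\<close> must be told apart.

  For a message with weight function \<open>f\<close> on the inputs \<open>X\<close>, Parseval bounds the square of its
  advantage by the Fourier weight of \<open>f\<close> on the sets \<open>p ` blocks k V\<close> with \<open>|V|\<close> odd, on average over
  \<open>p\<close>. For \<open>V\<close> of medium size Parseval and a binomial estimate suffice. For small \<open>V\<close>, the average over \<open>p\<close>
  is dominated by the sum over all tuples of indices, which equals a moment of the correlation of two
  inputs drawn from \<open>f\<close>; as \<open>f\<close> has density at least \<open>2^{-s}\<close> this is controlled by the moments of a sum
  of independent signs. This loses a square against hypercontractivity, which the choice
  \<open>k = 2t\<close> instead of \<open>k = t\<close> pays for. Large \<open>V\<close> reduce to small ones by complementation.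
\<close>

section \<open>Disjoint unions of cycles\<close>

lemma parabola_chord:
  fixes a b :: real and z :: "real^2"
  assumes "z \<in> closed_segment (vector [a, a\<^sup>2]) (vector [b, b\<^sup>2])" "a < b"
  shows "a \<le> z $ 1" "z $ 1 \<le> b" "z $ 2 - (z $ 1)\<^sup>2 = (z $ 1 - a) * (b - z $ 1)"
proof -
  obtain u where u: "0 \<le> u" "u \<le> 1" and z: "z = (1 - u) *\<^sub>R vector [a, a\<^sup>2] + u *\<^sub>R vector [b, b\<^sup>2]"
    using assms(1) unfolding closed_segment_def by blast
  have z1: "z $ 1 = a + u * (b - a)" and z2: "z $ 2 = (1 - u) * a\<^sup>2 + u * b\<^sup>2"
    unfolding z by (simp_all add: algebra_simps)
  show "a \<le> z $ 1" using u assms z1 by simp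
  have "u * (b - a) \<le> 1 * (b - a)" using u assms by (intro mult_right_mono) auto
  then show "z $ 1 \<le> b" using z1 by simp
  show "z $ 2 - (z $ 1)\<^sup>2 = (z $ 1 - a) * (b - z $ 1)"
    unfolding z1 z2 by (simp add: algebra_simps power2_eq_square)
qed

text \<open>At a common point with abscissa \<open>x\<close> both chords have the same height above
  the parabola, that is \<open>(x - a) * (b - x) = (x - c) * (d - x)\<close>. Noncrossing intervals
  are separated or nested. Separated ones share at most an end; for nested ones the difference of
  the heights is a sum of two nonnegative products, which must both vanish.\<close>

lemma parabola_chords_disjoint:
  fixes a b c d :: real and z :: "real^2"
  assumes "z \<in> closed_segment (vector [a, a\<^sup>2]) (vector [b, b\<^sup>2])" "a < b"
    and "z \<in> closed_segment (vector [c, c\<^sup>2]) (vector [d, d\<^sup>2])" "c < d"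
    and nc: "\<not> (a < c \<and> c < b \<and> b < d)" "\<not> (c < a \<and> a < d \<and> d < b)" and ne: "(a, b) \<noteq> (c, d)"
  shows "z = vector [z $ 1, (z $ 1)\<^sup>2] \<and> (z $ 1 = a \<or> z $ 1 = b) \<and> (z $ 1 = c \<or> z $ 1 = d)"
proof -
  define x where "x = z $ 1"
  note p = parabola_chord[OF assms(1,2), folded x_def] parabola_chord[OF assms(3,4), folded x_def]
  have eq: "(x - a) * (b - x) = (x - c) * (d - x)" using p by simp
  have *: "(x = a \<or> x = b) \<and> (x = c \<or> x = d)"
  proof -
    consider "b \<le> c" | "d \<le> a" | "a \<le> c" "d \<le> b" | "c \<le> a" "b \<le> d" using nc by linarith
    then show ?thesis
    proof cases
      case 3
      have "(x - a) * (b - x) = (x-c)*(d-x) + (x-c)*(b-d) + (c-a)*(b-x)" by (simp add: algebra_simps)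
      then have "(x-c)*(b-d) + (c-a)*(b-x) = 0" using eq by simp
      moreover have "(x-c)*(b-d) \<ge> 0" "(c-a)*(b-x) \<ge> 0" using 3 p by auto
      ultimately have "(x-c)*(b-d) = 0" "(c-a)*(b-x) = 0" by linarith+
      then show ?thesis using ne p 3 by auto
    next
      case 4
      have "(x - c) * (d - x) = (x-a)*(b-x) + (x-a)*(d-b) + (a-c)*(d-x)" by (simp add: algebra_simps)
      then have "(x-a)*(d-b) + (a-c)*(d-x) = 0" using eq by simp
      moreover have "(x-a)*(d-b) \<ge> 0" "(a-c)*(d-x) \<ge> 0" using 4 p by auto
      ultimately have "(x-a)*(d-b) = 0" "(a-c)*(d-x) = 0" by linarith+
      then show ?thesis using ne p 4 by auto
    qed (use p in auto)
  qed
  then have "z $ 2 = x\<^sup>2" using p(3) by auto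
  then have "z = vector [z $ 1, (z $ 1)\<^sup>2]" by (simp add: vec_eq_iff forall_2 x_def)
  with * show ?thesis by (simp add: x_def)
qed

text \<open>A one-page book embedding: the ranks \<open>r\<close> put the vertices in convex
  position, and chords whose ends do not interleave cannot cross. Since the ends of an edge may be
  listed in either order and the two edges may be exchanged, the single pattern in \<open>nc\<close>
  covers every interleaving.\<close>

lemma planar_noncrossing:
  fixes r :: "'a \<Rightarrow> nat"
  assumes inj: "inj_on r V"
    and edge: "\<And>e. e \<in> E \<Longrightarrow> e \<subseteq> V \<and> card e = 2"
    and nc: "\<And>a b c d. {a, b} \<in> E \<Longrightarrow> {c, d} \<in> E \<Longrightarrow> r a < r c \<Longrightarrow> r c < r b \<Longrightarrow> r b < r d \<Longrightarrow> False"
  shows "planar V E"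
proof -
  define pos :: "'a \<Rightarrow> real^2" where "pos v = vector [real (r v), (real (r v))\<^sup>2]" for v
  have pos1: "pos v $ 1 = real (r v)" for v by (simp add: pos_def)
  have "\<exists>a b. e = {a, b} \<and> r a < r b" if "e \<in> E" for e
  proof -
    obtain a b where ab: "e = {a, b}" "a \<noteq> b" using edge[OF \<open>e \<in> E\<close>] by (meson card_2_iff)
    then have "r a \<noteq> r b" using inj edge[OF that] by (auto simp: inj_on_def)
    then show ?thesis using ab by (metis insert_commute linorder_neqE_nat)
  qed
  then obtain lo hi where e: "\<And>e. e \<in> E \<Longrightarrow> e = {lo e, hi e} \<and> r (lo e) < r (hi e)" by metis
  define \<gamma> where "\<gamma> e = linepath (pos (lo e)) (pos (hi e))" for e
  have V: "lo e \<in> V" "hi e \<in> V" if "e \<in> E" for e using e[OF that] edge[OF that] by auto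
  have injpos: "inj_on pos V" using inj unfolding inj_on_def by (metis of_nat_eq_iff pos1)
  have rlt: "real (r (lo e)) < real (r (hi e))" if "e \<in> E" for e using e[OF that] by simp
  have mem: "z \<in> closed_segment (vector [real (r (lo e)), (real (r (lo e)))\<^sup>2]) (vector [real (r (hi e)), (real (r (hi e)))\<^sup>2])"
    if "z \<in> path_image (\<gamma> e)" for z e using that by (simp add: \<gamma>_def pos_def)
  have "arc (\<gamma> e) \<and> {pathstart (\<gamma> e), pathfinish (\<gamma> e)} = pos ` e \<and> path_image (\<gamma> e) \<inter> pos ` V = pos ` e"
    if E: "e \<in> E" for e
  proof (intro conjI)
    have "pos (lo e) \<noteq> pos (hi e)" using pos1 rlt[OF E] by (metis less_irrefl)
    then show "arc (\<gamma> e)" unfolding \<gamma>_def by simp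
    have pe: "pos ` e = {pos (lo e), pos (hi e)}" using e[OF E] by (metis image_empty image_insert)
    then show "{pathstart (\<gamma> e), pathfinish (\<gamma> e)} = pos ` e" by (simp add: \<gamma>_def)
    show "path_image (\<gamma> e) \<inter> pos ` V = pos ` e"
    proof
      show "pos ` e \<subseteq> path_image (\<gamma> e) \<inter> pos ` V" using V[OF E] by (simp add: pe \<gamma>_def)
      show "path_image (\<gamma> e) \<inter> pos ` V \<subseteq> pos ` e"
      proof
        fix z assume "z \<in> path_image (\<gamma> e) \<inter> pos ` V"
        then obtain v where v: "v \<in> V" "z = pos v" "z \<in> path_image (\<gamma> e)" by auto
        \<comment> \<open>A vertex has height zero above the parabola, so on a chord it can only be
          an end.\<close>
        from parabola_chord(3)[OF mem[OF v(3)] rlt[OF E]] v(2)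
        have "(real (r v) - r (lo e)) * (r (hi e) - real (r v)) = 0" by (simp add: pos_def)
        then have "r v = r (lo e) \<or> r v = r (hi e)" by auto
        then show "z \<in> pos ` e" using inj v V[OF E] pe by (auto simp: inj_on_def)
      qed
    qed
  qed
  moreover have "path_image (\<gamma> e) \<inter> path_image (\<gamma> f) = pos ` (e \<inter> f)"
    if E: "e \<in> E" "f \<in> E" "e \<noteq> f" for e f
  proof
    have sub: "pos ` e \<subseteq> path_image (\<gamma> e)" if "e \<in> E" for e
      using e[OF that] by (metis \<gamma>_def ends_in_segment(1,2) image_empty image_insert insert_subset empty_subsetI path_image_linepath)
    show "pos ` (e \<inter> f) \<subseteq> path_image (\<gamma> e) \<inter> path_image (\<gamma> f)" using sub[OF E(1)] sub[OF E(2)] by auto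
    show "path_image (\<gamma> e) \<inter> path_image (\<gamma> f) \<subseteq> pos ` (e \<inter> f)"
    proof
      fix z assume z: "z \<in> path_image (\<gamma> e) \<inter> path_image (\<gamma> f)"
      have n1: "\<not> (r (lo e) < r (lo f) \<and> r (lo f) < r (hi e) \<and> r (hi e) < r (hi f))"
        using nc[of "lo e" "hi e" "lo f" "hi f"] e[OF E(1)] e[OF E(2)] E by auto
      have n2: "\<not> (r (lo f) < r (lo e) \<and> r (lo e) < r (hi f) \<and> r (hi f) < r (hi e))"
        using nc[of "lo f" "hi f" "lo e" "hi e"] e[OF E(1)] e[OF E(2)] E by auto
      have n3: "(r (lo e), r (hi e)) \<noteq> (r (lo f), r (hi f))"
        using inj V[OF E(1)] V[OF E(2)] e[OF E(1)] e[OF E(2)] E(3) by (metis Pair_inject inj_onD)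
      have *: "z = vector [z $ 1, (z $ 1)\<^sup>2] \<and> (z $ 1 = r (lo e) \<or> z $ 1 = r (hi e)) \<and> (z $ 1 = r (lo f) \<or> z $ 1 = r (hi f))"
        by (rule parabola_chords_disjoint[OF mem rlt mem rlt]) (use z E n1 n2 n3 in auto)
      then obtain v where v: "v \<in> e" "z $ 1 = r v" using e[OF E(1)] by blast
      obtain w where w: "w \<in> f" "z $ 1 = r w" using * e[OF E(2)] by blast
      have "v = w" using v w inj edge[OF E(1)] edge[OF E(2)] by (metis inj_onD of_nat_eq_iff subset_iff)
      then show "z \<in> pos ` (e \<inter> f)" using v w * by (metis IntI imageI pos_def)
    qed
  qed
  ultimately show ?thesis unfolding planar_def using injpos by blast
qed

section \<open>Unions of cycles on intervals of numbers\<close>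

definition cyc_succ :: "nat \<Rightarrow> nat \<Rightarrow> nat" where
  "cyc_succ L i = (if L dvd Suc i then Suc i - L else Suc i)"

text \<open>Each cycle lives on an interval of \<open>L\<close> consecutive numbers that starts at a
  multiple of \<open>L\<close>. In this order all edges but the closing ones join neighbours, which
  makes the noncrossing condition easy to check.\<close>

definition cycles :: "nat \<Rightarrow> nat \<Rightarrow> nat set set" where
  "cycles L h = (\<lambda>i. {i, cyc_succ L i}) ` {..<L * h}"

lemma cyc_succ_div:
  assumes "L > 0" shows "cyc_succ L i div L = i div L"
proof (cases "L dvd Suc i")
  case True
  then obtain q where q: "Suc i = L * q" by blast
  then obtain q' where "q = Suc q'" by (cases q) auto
  then have s: "Suc i - L = L * q'" and i: "i = (L - 1) + q' * L"
    using q assms by (auto simp: mult.commute)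
  have "i div L = q'" unfolding i using assms by (subst div_mult_self1) auto
  then show ?thesis using True assms s by (simp add: cyc_succ_def)
next
  case False
  then have "Suc i mod L \<noteq> 0" by (simp add: dvd_eq_mod_eq_0)
  then show ?thesis using False by (simp add: cyc_succ_def div_Suc)
qed

lemma cyc_succ_less:
  assumes "i < L * h" shows "cyc_succ L i < L * h"
proof -
  have "L > 0" using assms by (cases L) auto
  then show ?thesis using assms cyc_succ_div[of L i]
    by (metis div_less_iff_less_mult mult.commute)
qed

lemma cyc_succ_neq: "L \<ge> 2 \<Longrightarrow> cyc_succ L i \<noteq> i"
  using dvd_imp_le[of L "Suc i"] by (auto simp: cyc_succ_def)

lemma cyc_succ_twice_neq: 
  assumes "L \<ge> 3" shows "cyc_succ L (cyc_succ L i) \<noteq> i"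
proof (cases "L dvd Suc i")
  case True
  then have "L \<le> Suc i" by (rule dvd_imp_le) simp
  moreover have "L dvd Suc i - L" using True by simp
  then have "\<not> L dvd Suc (Suc i - L)" using assms by (metis One_nat_def dvd_1_iff_1 dvd_add_right_iff Suc_eq_plus1 nle_le numeral_le_one_iff semiring_norm(70))
  ultimately show ?thesis using True assms by (simp add: cyc_succ_def)
next
  case False
  then show ?thesis using assms dvd_imp_le[of L "Suc (Suc i)"] by (auto simp: cyc_succ_def)
qed

lemma inj_on_cycle_edges:
  assumes "L \<ge> 3" shows "inj_on (\<lambda>i. {i, cyc_succ L i}) A"
  by (rule inj_onI) (metis assms cyc_succ_twice_neq doubleton_eq_iff)

lemma card_cycles: "L \<ge> 3 \<Longrightarrow> card (cycles L h) = L * h"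
  unfolding cycles_def by (subst card_image) (auto intro: inj_on_cycle_edges)

lemma cycles_edge:
  assumes "L \<ge> 3" "e \<in> cycles L h"
  shows "e \<subseteq> {..<L * h}" "card e = 2"
proof -
  obtain i where i: "i < L * h" "e = {i, cyc_succ L i}" using assms(2) by (auto simp: cycles_def)
  show "e \<subseteq> {..<L * h}" using i cyc_succ_less by auto
  show "card e = 2" using i cyc_succ_neq[of L i] assms(1) by (auto simp: card_2_iff)
qed

lemma cycles_long_edge:
  assumes "{a, b} \<in> cycles L h" "a + 1 < b" shows "L dvd a \<and> b + 1 = a + L"
proof -
  obtain i where i: "{a, b} = {i, cyc_succ L i}" using assms(1) by (auto simp: cycles_def)
  then consider "a = i" "b = cyc_succ L i" | "b = i" "a = cyc_succ L i" by (auto simp: doubleton_eq_iff)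
  then show ?thesis
  proof cases
    case 1
    then show ?thesis using assms(2) by (auto simp: cyc_succ_def split: if_splits)
  next
    case 2
    then have d: "L dvd Suc b" using assms(2) by (auto simp: cyc_succ_def split: if_splits)
    then have "L \<le> Suc b" by (rule dvd_imp_le) simp
    then show ?thesis using 2 d by (auto simp: cyc_succ_def)
  qed
qed

text \<open>Both edges skip a number, so both close an interval, and \<open>a\<close> and
  \<open>c\<close> are multiples of \<open>L\<close>. But no multiple of \<open>L\<close> lies
  strictly between \<open>a\<close> and \<open>a + L\<close>.\<close>

lemma cycles_noncrossing:
  assumes "{a, b} \<in> cycles L h" "{c, d} \<in> cycles L h" "a < c" "c < b" "b < d"
  shows False
proof -
  have "L dvd a" "b + 1 = a + L" "L dvd c"
    using cycles_long_edge[OF assms(1)] cycles_long_edge[OF assms(2)] assms by auto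
  then show False using assms(3,4)
    by (metis Suc_eq_plus1 add_diff_inverse_nat dvd_diff_nat dvd_imp_le less_Suc_eq_le nat_add_left_cancel_less
        nat_less_le not_less zero_less_diff)
qed

lemma planar_image_cycles:
  fixes \<phi> :: "nat \<Rightarrow> nat"
  assumes L: "L \<ge> 3" and inj: "inj_on \<phi> {..<L * h}" and V: "\<phi> ` {..<L * h} \<subseteq> V"
  shows "planar V ((`) \<phi> ` cycles L h)"
proof -
  define M where "M = L * h"
  \<comment> \<open>Vertices on the cycles are ranked by their position; all others come after them,
    so that \<open>r\<close> stays injective.\<close>
  define r where "r v = (if v \<in> \<phi> ` {..<M} then the_inv_into {..<M} \<phi> v else M + v)" for v
  have r: "r (\<phi> i) = i" if "i < M" for i using that inj by (auto simp: r_def M_def the_inv_into_f_f)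
  have r': "r v = M + v" if "v \<notin> \<phi> ` {..<M}" for v using that by (simp add: r_def)
  have injr: "inj_on r V"
    by (rule inj_onI) (metis (no_types, lifting) add_left_cancel imageE lessThan_iff not_add_less1 r r')
  show ?thesis
  proof (rule planar_noncrossing[OF injr])
    fix e assume "e \<in> (`) \<phi> ` cycles L h"
    then obtain e' where e': "e' \<in> cycles L h" "e = \<phi> ` e'" by auto
    have "inj_on \<phi> e'" using inj cycles_edge(1)[OF L e'(1)] inj_on_subset by blast
    then show "e \<subseteq> V \<and> card e = 2" using e' cycles_edge[OF L e'(1)] V by (auto simp: card_image)
  next
    fix a b c d assume ab: "{a, b} \<in> (`) \<phi> ` cycles L h" and cd: "{c, d} \<in> (`) \<phi> ` cycles L h"
      and less: "r a < r c" "r c < r b" "r b < r d"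
    have *: "{r a, r b} \<in> cycles L h" if ab: "{a, b} \<in> (`) \<phi> ` cycles L h" for a b
    proof -
      obtain e where e: "e \<in> cycles L h" "{a, b} = \<phi> ` e" using ab by blast
      have "r ` \<phi> ` e = e" using cycles_edge(1)[OF L e(1)] r by (force simp: M_def image_image)
      then show ?thesis using e by (metis image_empty image_insert)
    qed
    show False using cycles_noncrossing[OF *[OF ab] *[OF cd]] less by blast
  qed
qed

lemma simple_graph_image_cycles:
  assumes L: "L \<ge> 3" and inj: "inj_on \<phi> {..<L * h}" and V: "\<phi> ` {..<L * h} \<subseteq> V" "finite V"
  shows "simple_graph V ((`) \<phi> ` cycles L h)"
proof -
  have "\<phi> ` e \<subseteq> V \<and> card (\<phi> ` e) = 2" if "e \<in> cycles L h" for e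
  proof -
    have "inj_on \<phi> e" using inj cycles_edge(1)[OF L that] inj_on_subset by blast
    then show ?thesis using cycles_edge[OF L that] V by (auto simp: card_image)
  qed
  then show ?thesis using V by (auto simp: simple_graph_def)
qed

lemma card_image_cycles:
  assumes L: "L \<ge> 3" and inj: "inj_on \<phi> {..<L * h}"
  shows "card ((`) \<phi> ` cycles L h) = L * h"
proof -
  have "inj_on ((`) \<phi>) (cycles L h)"
    by (rule inj_on_subset[OF inj_on_image_Pow[OF inj]]) (use cycles_edge(1)[OF L] in auto)
  then show ?thesis using card_cycles[OF L] by (simp add: card_image)
qed

text \<open>Colour by the parity of the position: a step to the successor changes the position by 1,
  or by \<open>L - 1\<close> at the end of an interval, and both are odd. Vertices off the cycles
  join the second class.\<close>

lemma bipartite_even_cycles: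
  assumes L: "L \<ge> 3" "even L" and inj: "inj_on \<phi> {..<L * h}" and V: "\<phi> ` {..<L * h} \<subseteq> V"
  shows "bipartite V ((`) \<phi> ` cycles L h)"
proof -
  define X where "X = \<phi> ` {i. i < L * h \<and> even i}"
  have "\<exists>x\<in>X. \<exists>y\<in>V - X. \<phi> ` {i, cyc_succ L i} = {x, y}" if i: "i < L * h" for i
  proof -
    let ?s = "cyc_succ L i"
    have s: "?s < L * h" "even ?s \<noteq> even i"
      using i cyc_succ_less L(2) dvd_trans by (auto simp: cyc_succ_def dvd_imp_le)
    have *: "\<phi> j \<in> X \<longleftrightarrow> even j" "\<phi> j \<in> V" if "j < L * h" for j
      using that inj V unfolding X_def inj_on_def by auto
    show ?thesis
    proof (cases "even i")
      case True then show ?thesis using s * i by (intro bexI[of _ "\<phi> i"] bexI[of _ "\<phi> ?s"]) auto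
    next
      case False then show ?thesis using s * i by (intro bexI[of _ "\<phi> i"] bexI[of _ "\<phi> ?s"]) auto
    qed
  qed
  moreover have "X \<subseteq> V" using V by (auto simp: X_def)
  ultimately show ?thesis unfolding bipartite_def cycles_def
    by (intro exI[of _ X] exI[of _ "V - X"]) auto
qed

text \<open>Every odd cycle must lose an edge, and different cycles have no edge in common.\<close>

lemma odd_cycles_far:
  assumes L: "L \<ge> 3" "odd L" and inj: "inj_on \<phi> {..<L * h}"
    and F: "F \<subseteq> (`) \<phi> ` cycles L h" and bip: "bipartite V ((`) \<phi> ` cycles L h - F)"
  shows "h \<le> card F"
proof -
  obtain X Y where XY: "X \<inter> Y = {}" "\<And>e. e \<in> (`) \<phi> ` cycles L h - F \<Longrightarrow> \<exists>x\<in>X. \<exists>y\<in>Y. e = {x, y}"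
    using bip unfolding bipartite_def by metis
  define ed where "ed i = \<phi> ` {i, cyc_succ L i}" for i
  have "\<exists>i. i div L = q \<and> i < L * h \<and> ed i \<in> F" if q: "q < h" for q
  proof (rule ccontr)
    assume c: "\<not> ?thesis"
    have lt: "L * q + r < L * h" if "r < L" for r
    proof -
      have "L * q + r < L * (q + 1)" using that by simp
      also have "\<dots> \<le> L * h" using q by (intro mult_le_mono2) simp
      finally show ?thesis .
    qed
    have flip: "\<phi> (L * q + r) \<in> X \<longleftrightarrow> \<phi> (cyc_succ L (L * q + r)) \<notin> X" if "r < L" for r
    proof -
      have "ed (L * q + r) \<in> (`) \<phi> ` cycles L h"
        unfolding ed_def cycles_def using lt[OF that] by blast
      moreover have "ed (L * q + r) \<notin> F" using c that lt[OF that] by auto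
      ultimately have "ed (L * q + r) \<in> (`) \<phi> ` cycles L h - F" by blast
      from XY(2)[OF this] XY(1) show ?thesis unfolding ed_def by (auto simp: doubleton_eq_iff)
    qed
    \<comment> \<open>Along an untouched cycle membership in \<open>X\<close> alternates. As
      \<open>L - 1\<close> is even, the last position lies on the same side as position 0, its
      successor.\<close>
    have alt: "r < L \<Longrightarrow> \<phi> (L * q + r) \<in> X \<longleftrightarrow> (\<phi> (L * q) \<in> X) = even r" for r
    proof (induction r)
      case (Suc r)
      have "\<not> L dvd Suc (L * q + r)"
        using Suc.prems by (metis add_Suc_right dvd_add_right_iff dvd_triv_left nat_dvd_not_less zero_less_Suc)
      then have "cyc_succ L (L * q + r) = L * q + Suc r" by (simp add: cyc_succ_def)
      then show ?case using Suc flip[of r] by auto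
    qed simp
    have "cyc_succ L (L * q + (L - 1)) = L * q" using L by (simp add: cyc_succ_def)
    then show False using flip[of "L - 1"] alt[of "L - 1"] L by auto
  qed
  then obtain i where i: "\<And>q. q < h \<Longrightarrow> i q div L = q \<and> i q < L * h \<and> ed (i q) \<in> F" by metis
  have injed: "inj_on ed {..<L * h}"
  proof (rule inj_onI)
    fix a b assume a: "a \<in> {..<L * h}" "b \<in> {..<L * h}" "ed a = ed b"
    have "{a, cyc_succ L a} = {b, cyc_succ L b}"
      using a cyc_succ_less unfolding ed_def by (intro inj_on_image_eq_iff[OF inj, THEN iffD1]) auto
    then show "a = b" using inj_on_cycle_edges[OF L(1), of UNIV] by (auto dest: injD)
  qed
  have "inj_on (ed \<circ> i) {..<h}"
  proof (rule inj_onI)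
    fix p q assume pq: "p \<in> {..<h}" "q \<in> {..<h}" "(ed \<circ> i) p = (ed \<circ> i) q"
    then have "i p = i q" using inj_onD[OF injed] i by simp
    then show "p = q" using i pq(1,2) by (metis lessThan_iff)
  qed
  moreover have "(ed \<circ> i) ` {..<h} \<subseteq> F" using i by auto
  moreover have "finite F" using F by (rule finite_subset) (simp add: cycles_def)
  ultimately show ?thesis by (metis card_inj_on_le card_lessThan)
qed

section \<open>Fourier analysis on subsets\<close>

text \<open>This bounds \<open>cosh x\<close>, the moment generating function of a fair sign. It is
  the inequality behind Hoeffding's lemma for two equally likely values at distance
  \<open>2 * x\<close>.\<close>

lemma exp_add_exp_minus_le:
  fixes x :: real
  assumes "x \<ge> 0"
  shows "exp x + exp (- x) \<le> 2 * exp (x\<^sup>2 / 2)"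
proof -
  have pos: "1 + (1/2) * (exp (2 * x) - 1) > 0" using exp_gt_zero[of "2*x"] by (auto simp: field_simps add_pos_pos)
  have "- (2 * x) * (1/2) + ln (1 + (1/2) * (exp (2 * x) - 1)) \<le> (2 * x)\<^sup>2 / 8"
    by (rule Hoeffdings_lemma_aux) (use assms in auto)
  then have "ln (1 + (1/2) * (exp (2 * x) - 1)) \<le> x\<^sup>2 / 2 + x" by (simp add: power2_eq_square)
  then have "1 + (1/2) * (exp (2 * x) - 1) \<le> exp (x\<^sup>2 / 2 + x)" using pos by (metis exp_le_cancel_iff exp_ln)
  then have "exp (- x) * (1 + exp (2 * x)) \<le> exp (- x) * (2 * exp (x\<^sup>2 / 2 + x))"
    by (intro mult_left_mono) (auto simp: field_simps)
  then show ?thesis by (simp add: distrib_left mult.left_commute flip: exp_add)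
qed

section \<open>Walsh characters and Fourier coefficients\<close>

definition sgn_at :: "nat \<Rightarrow> nat set \<Rightarrow> real" where
  "sgn_at i X = (if i \<in> X then - 1 else 1)"

definition chi :: "nat set \<Rightarrow> nat set \<Rightarrow> real" where
  "chi T X = (\<Prod>i\<in>T. sgn_at i X)"

text \<open>Not normalised: it sums over the inputs instead of averaging, which puts the factor
  \<open>2 ^ card I\<close> into Parseval's identity.\<close>

definition coef :: "nat set \<Rightarrow> (nat set \<Rightarrow> real) \<Rightarrow> nat set \<Rightarrow> real" where
  "coef I h T = (\<Sum>X\<in>Pow I. h X * chi T X)"

lemma abs_sgn_at [simp]: "\<bar>sgn_at i X\<bar> = 1" and sgn_at_sq [simp]: "sgn_at i X * sgn_at i X = 1"
  by (auto simp: sgn_at_def)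

lemma abs_chi [simp]: "\<bar>chi T X\<bar> = 1"
  by (simp add: chi_def abs_prod)

lemma chi_sq [simp]: "chi T X * chi T X = 1"
  by (simp add: chi_def flip: prod.distrib)

text \<open>The sum over \<open>T\<close> is the expansion of a product over \<open>I\<close> with
  the factors \<open>sgn_at i X * sgn_at i Y + 1\<close>, and a factor vanishes as soon as
  \<open>X\<close> and \<open>Y\<close> differ at \<open>i\<close>.\<close>

lemma sum_chi_mult_chi:
  assumes "finite I" "X \<subseteq> I" "Y \<subseteq> I"
  shows "(\<Sum>T\<in>Pow I. chi T X * chi T Y) = (if X = Y then 2 ^ card I else 0)"
proof -
  have "(\<Sum>T\<in>Pow I. chi T X * chi T Y) = (\<Sum>T\<in>Pow I. (\<Prod>i\<in>T. sgn_at i X * sgn_at i Y) * (\<Prod>i\<in>I - T. 1))"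
    by (simp add: chi_def prod.distrib)
  also have "\<dots> = (\<Prod>i\<in>I. sgn_at i X * sgn_at i Y + 1)"
    by (rule prod_add[symmetric]) fact
  also have "\<dots> = (if X = Y then 2 ^ card I else 0)"
  proof (cases "X = Y")
    case False
    then obtain i where "i \<in> I" "(i \<in> X) \<noteq> (i \<in> Y)" using assms by blast
    then have "sgn_at i X * sgn_at i Y + 1 = 0" by (auto simp: sgn_at_def)
    then show ?thesis using False \<open>i \<in> I\<close> assms by (auto intro!: prod_zero)
  qed simp
  finally show ?thesis .
qed

lemma parseval:
  assumes "finite I"
  shows "(\<Sum>T\<in>Pow I. (coef I h T)\<^sup>2) = 2 ^ card I * (\<Sum>X\<in>Pow I. (h X)\<^sup>2)"
proof -
  have "(\<Sum>T\<in>Pow I. (coef I h T)\<^sup>2) = (\<Sum>T\<in>Pow I. \<Sum>X\<in>Pow I. \<Sum>Y\<in>Pow I. (h X * h Y) * (chi T X * chi T Y))"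
    by (simp add: coef_def power2_eq_square sum_product mult_ac)
  also have "\<dots> = (\<Sum>X\<in>Pow I. \<Sum>Y\<in>Pow I. (h X * h Y) * (\<Sum>T\<in>Pow I. chi T X * chi T Y))"
    by (subst sum.swap, rule sum.cong, simp, subst sum.swap, simp add: sum_distrib_left)
  also have "\<dots> = (\<Sum>X\<in>Pow I. \<Sum>Y\<in>Pow I. (if X = Y then (h X)\<^sup>2 * 2 ^ card I else 0))"
    by (intro sum.cong refl) (auto simp: sum_chi_mult_chi assms power2_eq_square)
  also have "\<dots> = 2 ^ card I * (\<Sum>X\<in>Pow I. (h X)\<^sup>2)"
    using assms by (simp add: sum_distrib_left mult_ac)
  finally show ?thesis .
qed

text \<open>As characters square to one, \<open>chi I\<close> times \<open>chi T\<close> is the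
  character of the complement. Multiplying \<open>h\<close> by \<open>chi I\<close> keeps its
  absolute value and turns its high levels into low ones.\<close>

lemma coef_complement:
  assumes "finite I" "T \<subseteq> I"
  shows "coef I h (I - T) = coef I (\<lambda>X. h X * chi I X) T"
proof -
  have "chi I X = chi T X * chi (I - T) X" for X
    unfolding chi_def using assms by (metis mult.commute prod.subset_diff)
  then have "chi I X * chi T X = chi (I - T) X" for X
    by (metis chi_sq mult.assoc mult.commute mult.right_neutral)
  then show ?thesis by (simp add: coef_def mult.assoc)
qed

section \<open>Moments of sums of independent signs\<close>

lemma sum_exp_signed:
  assumes "finite I" "x \<ge> 0" "\<And>i. i \<in> I \<Longrightarrow> \<bar>c i\<bar> = (1::real)"
  shows "(\<Sum>Y\<in>Pow I. exp (x * (\<Sum>i\<in>I. c i * sgn_at i Y))) \<le> 2 ^ card I * exp (x\<^sup>2 * card I / 2)"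
proof -
  \<comment> \<open>With one product over \<open>Y\<close> and one over its complement, the sum over
    \<open>Y\<close> becomes an expanded product by \<open>prod_add\<close>.\<close>
  have "exp (x * (\<Sum>i\<in>I. c i * sgn_at i Y)) = (\<Prod>i\<in>Y. exp (- (x * c i))) * (\<Prod>i\<in>I - Y. exp (x * c i))"
    if "Y \<in> Pow I" for Y
  proof -
    have "exp (x * (\<Sum>i\<in>I. c i * sgn_at i Y)) = (\<Prod>i\<in>I. exp (x * c i * sgn_at i Y))"
      using assms(1) by (simp add: sum_distrib_left exp_sum mult.assoc)
    also have "\<dots> = (\<Prod>i\<in>I - Y. exp (x * c i * sgn_at i Y)) * (\<Prod>i\<in>Y. exp (x * c i * sgn_at i Y))"
      using that assms(1) by (intro prod.subset_diff) auto
    finally show ?thesis by (simp add: sgn_at_def mult.commute)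
  qed
  then have "(\<Sum>Y\<in>Pow I. exp (x * (\<Sum>i\<in>I. c i * sgn_at i Y))) = (\<Prod>i\<in>I. exp (- (x * c i)) + exp (x * c i))"
    by (simp add: prod_add[OF assms(1)])
  also have "\<dots> \<le> (\<Prod>i\<in>I. 2 * exp (x\<^sup>2 / 2))"
  proof (intro prod_mono conjI)
    fix i assume "i \<in> I"
    then have "c i = 1 \<or> c i = - 1" using assms(3) by fastforce
    then show "exp (- (x * c i)) + exp (x * c i) \<le> 2 * exp (x\<^sup>2 / 2)"
      using exp_add_exp_minus_le[OF assms(2)] by auto
  qed (simp add: add_nonneg_nonneg)
  also have "\<dots> = 2 ^ card I * exp (x\<^sup>2 * card I / 2)"
    by (simp add: power_mult_distrib flip: exp_of_nat_mult)
  finally show ?thesis by (simp add: mult_ac)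
qed

text \<open>The tangent inequality \<open>z \<le> exp (z - 1)\<close> at \<open>z = x / n\<close>,
  raised to the power \<open>n\<close>.\<close>

lemma power_le_exp:
  fixes x :: real
  assumes "x \<ge> 0" "n > 0"
  shows "x ^ n \<le> real n ^ n * exp (x - n)"
proof -
  have "x / n \<le> exp (x / n - 1)" using exp_ge_add_one_self[of "x / n - 1"] by simp
  then have "(x / n) ^ n \<le> exp (x / n - 1) ^ n" using assms by (intro power_mono) auto
  also have "\<dots> = exp (x - n)" using assms by (simp add: right_diff_distrib flip: exp_of_nat_mult)
  finally show ?thesis using assms by (simp add: power_divide field_simps)
qed

text \<open>Chernoff's argument: optimise \<open>x\<close> in \<open>z\<^sup>n \<le> (n/e)\<^sup>n exp (x z) / x\<^sup>n\<close> with \<open>z\<close> the sum of signs.\<close>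

lemma sum_signed_moment:
  assumes "finite I" "I \<noteq> {}" "m > 0" and c: "\<And>i. i \<in> I \<Longrightarrow> \<bar>c i\<bar> = (1::real)"
  shows "(\<Sum>Y\<in>Pow I. (\<Sum>i\<in>I. c i * sgn_at i Y) ^ (2 * m)) \<le> 2 ^ card I * (2 * real m * real (card I)) ^ m"
proof -
  define N where "N = real (card I)"
  define n where "n = 2 * real m"
  define x where "x = sqrt (n / N)"
  define z where "z Y = (\<Sum>i\<in>I. c i * sgn_at i Y)" for Y
  have N: "N > 0" using assms by (simp add: N_def card_gt_0_iff)
  have n: "n > 0" using assms by (simp add: n_def)
  have x: "x > 0" "x\<^sup>2 = n / N" using N n by (simp_all add: x_def)
  have neg: "- z Y = (\<Sum>i\<in>I. (- c i) * sgn_at i Y)" for Y by (simp add: z_def sum_negf)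
  have s1: "(\<Sum>Y\<in>Pow I. exp (x * z Y)) \<le> 2 ^ card I * exp (x\<^sup>2 * N / 2)"
    unfolding z_def N_def using assms x by (intro sum_exp_signed) auto
  have s2: "(\<Sum>Y\<in>Pow I. exp (x * - z Y)) \<le> 2 ^ card I * exp (x\<^sup>2 * N / 2)"
    unfolding neg N_def using assms x by (intro sum_exp_signed) auto
  have ex: "x\<^sup>2 * N / 2 = m" using x N by (simp add: n_def)
  have pt: "(x * z Y) ^ (2 * m) \<le> n ^ (2 * m) * exp (- n) * (exp (x * z Y) + exp (x * - z Y))" for Y
  proof -
    have "(x * z Y) ^ (2 * m) = \<bar>x * z Y\<bar> ^ (2 * m)" by (simp add: power_even_abs)
    also have "\<dots> \<le> n ^ (2 * m) * exp (\<bar>x * z Y\<bar> - n)"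
      using power_le_exp[of "\<bar>x * z Y\<bar>" "2 * m"] assms by (simp add: n_def)
    also have "\<dots> = n ^ (2 * m) * exp (- n) * exp \<bar>x * z Y\<bar>" by (simp add: exp_diff exp_minus field_simps)
    also have "\<dots> \<le> n ^ (2 * m) * exp (- n) * (exp (x * z Y) + exp (x * - z Y))"
      using n by (intro mult_left_mono) (auto simp: abs_if)
    finally show ?thesis .
  qed
  \<comment> \<open>Replacing the absolute value in the exponent by both signs costs a factor 2; it
    is recovered from \<open>exp (- real m)\<close>, as \<open>m\<close> is at least 1.\<close>
  have em: "2 \<le> exp (real m)" using exp_ge_add_one_self[of "real m"] \<open>m > 0\<close> by linarith
  have "x ^ (2 * m) * (\<Sum>Y\<in>Pow I. z Y ^ (2 * m)) = (\<Sum>Y\<in>Pow I. (x * z Y) ^ (2 * m))"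
    by (simp add: sum_distrib_left power_mult_distrib)
  also have "\<dots> \<le> n ^ (2 * m) * exp (- n) * ((\<Sum>Y\<in>Pow I. exp (x * z Y)) + (\<Sum>Y\<in>Pow I. exp (x * - z Y)))"
    unfolding sum.distrib[symmetric] sum_distrib_left by (intro sum_mono pt)
  also have "\<dots> \<le> n ^ (2 * m) * exp (- n) * (2 ^ card I * exp (real m) + 2 ^ card I * exp (real m))"
    using n s1 s2 unfolding ex by (intro mult_left_mono add_mono) auto
  also have "\<dots> = n ^ (2 * m) * 2 ^ card I * (2 * (exp (- n) * exp (real m)))" by (simp add: algebra_simps)
  also have "exp (- n) * exp (real m) = exp (- real m)" by (simp add: n_def flip: exp_add)
  also have "2 * exp (- real m) \<le> 1" using em by (simp add: exp_minus field_simps)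
  finally have "x ^ (2 * m) * (\<Sum>Y\<in>Pow I. z Y ^ (2 * m)) \<le> n ^ (2 * m) * 2 ^ card I"
    using n by simp
  moreover have "x ^ (2 * m) = (n / N) ^ m" using x by (simp add: power_mult)
  moreover have nn: "n ^ (2 * m) = (n / N) ^ m * (n * N) ^ m"
    using N by (simp add: power_mult power2_eq_square flip: power_mult_distrib)
  ultimately have "(n / N) ^ m * (\<Sum>Y\<in>Pow I. z Y ^ (2 * m)) \<le> (n / N) ^ m * (2 ^ card I * (n * N) ^ m)"
    using nn by (simp add: mult_ac)
  then show ?thesis using n N by (simp add: z_def n_def N_def)
qed

section \<open>Averages over permutations\<close>

lemma card_permutations_agreeing:
  assumes I: "finite I" and T: "T \<subseteq> I"
  shows "card {p. p permutes I \<and> restrict p T = f} \<le> fact (card I - card T)"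
proof (cases "\<exists>q. q permutes I \<and> restrict q T = f")
  case True
  then obtain q where q: "q permutes I" "restrict q T = f" by blast
  \<comment> \<open>Composing with \<open>inv q\<close> maps the permutations that agree with
    \<open>q\<close> on \<open>T\<close> injectively to permutations that fix \<open>T\<close>
    pointwise.\<close>
  have "card {p. p permutes I \<and> restrict p T = f} \<le> card {p. p permutes (I - T)}"
  proof (rule card_inj_on_le[where f = "\<lambda>p. inv q \<circ> p"])
    show "inj_on (\<lambda>p. inv q \<circ> p) {p. p permutes I \<and> restrict p T = f}"
    proof (rule inj_onI)
      fix p p' assume "inv q \<circ> p = inv q \<circ> p'"
      then have "q \<circ> (inv q \<circ> p) = q \<circ> (inv q \<circ> p')" by simp
      then show "p = p'" using permutes_inv_o(1)[OF q(1)] by (simp flip: comp_assoc)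
    qed
    show "(\<lambda>p. inv q \<circ> p) ` {p. p permutes I \<and> restrict p T = f} \<subseteq> {p. p permutes (I - T)}"
    proof clarify
      fix p assume p: "p permutes I" "f = restrict p T"
      have "inv q \<circ> p permutes I" using p q permutes_compose permutes_inv by blast
      moreover have "(inv q \<circ> p) x = x" if "x \<in> T" for x
      proof -
        have "p x = q x" using p q that by (metis restrict_apply')
        then show ?thesis using permutes_inverses[OF q(1)] by simp
      qed
      ultimately show "inv q \<circ> p permutes (I - T)" by (rule permutes_superset) auto
    qed
    show "finite {p. p permutes (I - T)}" using I by (simp add: finite_permutations)
  qed
  also have "\<dots> = fact (card I - card T)"
    using I T by (intro card_permutations) (auto simp: card_Diff_subset finite_subset)
  finally show ?thesis .
next
  case False
  then have "{p. p permutes I \<and> restrict p T = f} = {}" by blast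
  then show ?thesis by (simp only: card.empty)
qed

text \<open>Sampling without replacement is dominated by sampling with replacement: permutations are
  grouped by their restriction to \<open>T\<close>, and as \<open>G\<close> is nonnegative the sum
  may be extended to all maps from \<open>T\<close> to \<open>I\<close>.\<close>

lemma sum_permutations_le_sum_PiE:
  fixes G :: "(nat \<Rightarrow> nat) \<Rightarrow> real"
  assumes I: "finite I" and T: "T \<subseteq> I" and G: "\<And>f. G f \<ge> 0"
  shows "(\<Sum>p | p permutes I. G (restrict p T)) \<le> fact (card I - card T) * (\<Sum>f\<in>T \<rightarrow>\<^sub>E I. G f)"
proof -
  have fin: "finite (T \<rightarrow>\<^sub>E I)" "finite {p. p permutes I}"
    using I T finite_subset by (auto intro!: finite_PiE finite_permutations)
  have "(\<Sum>p | p permutes I. G (restrict p T)) =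
        (\<Sum>f\<in>T \<rightarrow>\<^sub>E I. \<Sum>p\<in>{p \<in> {p. p permutes I}. restrict p T = f}. G (restrict p T))"
    using T by (intro sum.group[symmetric] fin) (force simp: permutes_in_image)
  also have "\<dots> = (\<Sum>f\<in>T \<rightarrow>\<^sub>E I. card {p. p permutes I \<and> restrict p T = f} * G f)" by simp
  also have "\<dots> \<le> (\<Sum>f\<in>T \<rightarrow>\<^sub>E I. fact (card I - card T) * G f)"
    using card_permutations_agreeing[OF I T] G
    by (intro sum_mono mult_right_mono) (metis of_nat_fact of_nat_le_iff)+
  finally show ?thesis by (simp add: sum_distrib_left)
qed

definition corr :: "nat set \<Rightarrow> nat set \<Rightarrow> nat set \<Rightarrow> real" where
  "corr I X Y = (\<Sum>i\<in>I. sgn_at i X * sgn_at i Y)"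

text \<open>Expanding the square brings in a second input \<open>Y\<close>. Summed over all maps
  from \<open>T\<close> to \<open>I\<close>, the product of signs becomes a power of
  \<open>corr I X Y\<close>. The exponent is even, so passing to absolute values of \<open>h\<close>
  only increases the sum.\<close>

lemma sum_permutations_coef_le:
  assumes I: "finite I" and T: "T \<subseteq> I" and ev: "even (card T)"
  shows "(\<Sum>p | p permutes I. (coef I h (p ` T))\<^sup>2) \<le>
         fact (card I - card T) * (\<Sum>X\<in>Pow I. \<Sum>Y\<in>Pow I. \<bar>h X\<bar> * \<bar>h Y\<bar> * corr I X Y ^ card T)"
proof -
  define G where "G f = (\<Sum>X\<in>Pow I. h X * (\<Prod>i\<in>T. sgn_at (f i) X))\<^sup>2" for f
  have "(coef I h (p ` T))\<^sup>2 = G (restrict p T)" if "p permutes I" for p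
  proof -
    have "inj_on p T" using that by (rule permutes_inj_on)
    then show ?thesis by (simp add: G_def coef_def chi_def prod.reindex)
  qed
  then have "(\<Sum>p | p permutes I. (coef I h (p ` T))\<^sup>2) = (\<Sum>p | p permutes I. G (restrict p T))" by simp
  also have "\<dots> \<le> fact (card I - card T) * (\<Sum>f\<in>T \<rightarrow>\<^sub>E I. G f)"
    by (rule sum_permutations_le_sum_PiE[OF I T]) (simp add: G_def)
  also have "(\<Sum>f\<in>T \<rightarrow>\<^sub>E I. G f) =
      (\<Sum>f\<in>T \<rightarrow>\<^sub>E I. \<Sum>X\<in>Pow I. \<Sum>Y\<in>Pow I. h X * h Y * (\<Prod>i\<in>T. sgn_at (f i) X * sgn_at (f i) Y))"
    by (simp add: G_def power2_eq_square sum_product prod.distrib mult_ac)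
  also have "\<dots> = (\<Sum>X\<in>Pow I. \<Sum>Y\<in>Pow I. h X * h Y * (\<Sum>f\<in>T \<rightarrow>\<^sub>E I. \<Prod>i\<in>T. sgn_at (f i) X * sgn_at (f i) Y))"
    by (subst sum.swap, rule sum.cong, simp, subst sum.swap, simp add: sum_distrib_left)
  also have "\<dots> = (\<Sum>X\<in>Pow I. \<Sum>Y\<in>Pow I. h X * h Y * corr I X Y ^ card T)"
  proof -
    have "finite T" using I T by (rule rev_finite_subset)
    then have "(\<Sum>f\<in>T \<rightarrow>\<^sub>E I. \<Prod>i\<in>T. sgn_at (f i) X * sgn_at (f i) Y) = corr I X Y ^ card T" for X Y
      using prod_sum_PiE[of T "\<lambda>_. I" "\<lambda>_ j. sgn_at j X * sgn_at j Y"] I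
      by (simp add: corr_def)
    then show ?thesis by simp
  qed
  also have "\<dots> \<le> (\<Sum>X\<in>Pow I. \<Sum>Y\<in>Pow I. \<bar>h X\<bar> * \<bar>h Y\<bar> * corr I X Y ^ card T)"
    using ev by (intro sum_mono mult_right_mono) (auto simp: zero_le_even_power abs_mult[symmetric])
  finally show ?thesis by simp
qed

section \<open>Fourier weight on random unions of blocks\<close>

definition blocks :: "nat \<Rightarrow> nat set \<Rightarrow> nat set" where
  "blocks k V = {i. i div k \<in> V}"

lemma blocks_eq_image:
  assumes "k > 0" shows "blocks k V = (\<lambda>(j, r). j * k + r) ` (V \<times> {..<k})"
proof
  show "blocks k V \<subseteq> (\<lambda>(j, r). j * k + r) ` (V \<times> {..<k})"
  proof
    fix i assume "i \<in> blocks k V"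
    then have "(i div k, i mod k) \<in> V \<times> {..<k}" using assms by (simp add: blocks_def)
    then show "i \<in> (\<lambda>(j, r). j * k + r) ` (V \<times> {..<k})" by (rule rev_image_eqI) simp
  qed
qed (use assms in \<open>auto simp: blocks_def\<close>)

lemma inj_on_block_index:
  fixes k :: nat
  assumes "k > 0" shows "inj_on (\<lambda>(j, r). j * k + r) (V \<times> {..<k})"
proof (rule inj_onI, clarsimp)
  fix a b c d assume *: "b < k" "d < k" "a * k + b = c * k + d"
  then have "(a * k + b) div k = (c * k + d) div k" by simp
  then have "a = c" using *(1,2) assms by (simp add: div_add1_eq)
  then show "a = c \<and> b = d" using *(3) by simp
qed

lemma card_blocks:
  assumes "k > 0" shows "card (blocks k V) = k * card V"
proof -
  show ?thesis unfolding blocks_eq_image[OF assms]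
    by (subst card_image[OF inj_on_block_index[OF assms]]) (auto simp: card_cartesian_product)
qed

lemma blocks_subset: "V \<subseteq> {..<g} \<Longrightarrow> k > 0 \<Longrightarrow> blocks k V \<subseteq> {..<k * g}"
  by (auto simp: blocks_def div_less_iff_less_mult mult.commute dest!: subsetD)

lemma blocks_compl: "k > 0 \<Longrightarrow> blocks k ({..<g} - V) = {..<k * g} - blocks k V"
  by (auto simp: blocks_def div_less_iff_less_mult mult.commute)

section \<open>Small unions of blocks\<close>

lemma power_mult_fact_diff_le:
  assumes "2 * l \<le> N" shows "real N ^ l * fact (N - l) \<le> 2 ^ l * fact N"
  using assms
proof (induction l)
  case (Suc l)
  have f: "fact (N - l) = real (N - l) * fact (N - Suc l)"
    using Suc.prems by (metis Suc_diff_Suc Suc_le_lessD fact_Suc le_add2 mult_2 order_trans)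
  \<comment> \<open>Every factor \<open>N - l\<close> that is split off from the factorial is at
    least \<open>N / 2\<close>.\<close>
  have "real N ^ Suc l * fact (N - Suc l) \<le> real N ^ l * (2 * real (N - l)) * fact (N - Suc l)"
    using Suc.prems by (auto intro!: mult_right_mono mult_left_mono simp: of_nat_diff)
  also have "\<dots> = 2 * (real N ^ l * fact (N - l))" by (simp add: f)
  also have "\<dots> \<le> 2 * (2 ^ l * fact N)" using Suc by simp
  finally show ?case by simp
qed simp

lemma power_le_one_add_power:
  fixes x :: real
  assumes "x \<ge> 0" "j \<le> J" shows "x ^ j \<le> 1 + x ^ J"
proof (cases "x \<le> 1")
  case True
  then show ?thesis using assms by (simp add: power_le_one add_increasing2)
next
  case False
  then show ?thesis using assms power_increasing[of j J x] by linarith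
qed

lemma sum_nonempty_power_card:
  fixes x :: real
  assumes "finite A" shows "(\<Sum>V | V \<subseteq> A \<and> V \<noteq> {}. x ^ card V) = (1 + x) ^ card A - 1"
proof -
  have "(1 + x) ^ card A = (\<Prod>i\<in>A. x + 1)" by (simp add: add.commute)
  also have "\<dots> = (\<Sum>V\<in>Pow A. x ^ card V)"
    unfolding prod_add[OF assms] using assms by simp
  also have "\<dots> = x ^ card ({}::'a set) + (\<Sum>V\<in>Pow A - {{}}. x ^ card V)"
    using assms by (intro sum.remove) auto
  also have "Pow A - {{}} = {V. V \<subseteq> A \<and> V \<noteq> {}}" by auto
  finally show ?thesis by simp
qed

text \<open>The summand 1 contributes \<open>F\<^sup>2\<close>. For the other one, the weight of
  \<open>Y\<close> is bounded by 1 and the moment of order \<open>2 * t * J\<close> of a sum of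
  \<open>N\<close> signs is used; this brings a factor \<open>2 ^ N\<close>, at most
  \<open>2 ^ s * F\<close>. Normalised by \<open>2 / N\<close>, the moment is the power
  \<open>J\<close> of \<open>(g / \<theta>) * (4 * J / g) ^ t\<close>, so it is at most
  \<open>1 / 2 ^ J\<close> and pays for \<open>2 ^ s\<close>.\<close>

lemma low_correlation_bound:
  fixes t g J s :: nat and \<theta> :: real
  defines "N \<equiv> 2 * t * g"
  defines "I \<equiv> {..<N}"
  assumes pos: "t > 0" "g > 0" "J > 0" "0 < \<theta>"
    and cond: "(g / \<theta>) * (4 * J / g) ^ t \<le> 1 / 2" and sJ: "s \<le> J"
    and h: "\<And>X. \<bar>h X\<bar> \<le> 1" and F: "F = (\<Sum>X\<in>Pow I. \<bar>h X\<bar>)" "2 ^ N \<le> 2 ^ s * F"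
  shows "(\<Sum>X\<in>Pow I. \<Sum>Y\<in>Pow I. \<bar>h X\<bar> * \<bar>h Y\<bar> * (1 + (g / \<theta> * (2 / N * corr I X Y) ^ (2 * t)) ^ J)) \<le> 2 * F\<^sup>2"
proof -
  define c where "c = (g / \<theta>) ^ J * (2 / N) ^ (2 * t * J)"
  have N: "N > 0" using pos by (simp add: N_def)
  have c0: "c \<ge> 0" using pos by (simp add: c_def)
  have F0: "F \<ge> 0" unfolding F by (simp add: sum_nonneg)
  have eq: "(g / \<theta> * (2 / N * D) ^ (2 * t)) ^ J = c * D ^ (2 * (t * J))" for D :: real
  proof -
    have "(g / \<theta> * (2 / N * D) ^ (2 * t)) ^ J = (g / \<theta>) ^ J * ((2 / N) ^ (2 * t) * D ^ (2 * t)) ^ J"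
      by (simp only: power_mult_distrib)
    also have "\<dots> = (g / \<theta>) ^ J * (((2 / N) ^ (2 * t)) ^ J * (D ^ (2 * t)) ^ J)" by (simp only: power_mult_distrib)
    finally show ?thesis by (simp only: c_def power_mult[symmetric] mult.assoc)
  qed
  have "(\<Sum>X\<in>Pow I. \<Sum>Y\<in>Pow I. \<bar>h X\<bar> * \<bar>h Y\<bar> * (1 + (g / \<theta> * (2 / N * corr I X Y) ^ (2 * t)) ^ J))
     = (\<Sum>X\<in>Pow I. \<Sum>Y\<in>Pow I. \<bar>h X\<bar> * \<bar>h Y\<bar>) + c * (\<Sum>X\<in>Pow I. \<Sum>Y\<in>Pow I. \<bar>h X\<bar> * \<bar>h Y\<bar> * corr I X Y ^ (2 * (t * J)))"
    unfolding eq by (simp add: distrib_left sum.distrib sum_distrib_left mult_ac)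
  also have "(\<Sum>X\<in>Pow I. \<Sum>Y\<in>Pow I. \<bar>h X\<bar> * \<bar>h Y\<bar>) = F\<^sup>2" by (simp add: F power2_eq_square sum_product)
  also have "(\<Sum>X\<in>Pow I. \<Sum>Y\<in>Pow I. \<bar>h X\<bar> * \<bar>h Y\<bar> * corr I X Y ^ (2 * (t * J))) \<le>
       (\<Sum>X\<in>Pow I. \<bar>h X\<bar> * (2 ^ N * (2 * real (t * J) * real N) ^ (t * J)))"
  proof (intro sum_mono)
    fix X
    have "(\<Sum>Y\<in>Pow I. \<bar>h X\<bar> * \<bar>h Y\<bar> * corr I X Y ^ (2 * (t * J))) \<le> (\<Sum>Y\<in>Pow I. \<bar>h X\<bar> * 1 * corr I X Y ^ (2 * (t * J)))"
      using h by (intro sum_mono mult_right_mono mult_left_mono) (auto simp: zero_le_even_power)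
    also have "\<dots> = \<bar>h X\<bar> * (\<Sum>Y\<in>Pow I. corr I X Y ^ (2 * (t * J)))" by (simp add: sum_distrib_left)
    also have "\<dots> \<le> \<bar>h X\<bar> * (2 ^ card I * (2 * real (t * J) * real (card I)) ^ (t * J))"
      unfolding corr_def using pos N by (intro mult_left_mono sum_signed_moment) (auto simp: I_def)
    finally show "(\<Sum>Y\<in>Pow I. \<bar>h X\<bar> * \<bar>h Y\<bar> * corr I X Y ^ (2 * (t * J))) \<le> \<bar>h X\<bar> * (2 ^ N * (2 * real (t * J) * real N) ^ (t * J))"
      by (simp add: I_def)
  qed
  also have "\<dots> = F * 2 ^ N * (2 * real (t * J) * real N) ^ (t * J)" by (simp add: F sum_distrib_right mult.assoc)
  finally have 1: "(\<Sum>X\<in>Pow I. \<Sum>Y\<in>Pow I. \<bar>h X\<bar> * \<bar>h Y\<bar> * (1 + (g / \<theta> * (2 / N * corr I X Y) ^ (2 * t)) ^ J))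
     \<le> F\<^sup>2 + c * (F * 2 ^ N * (2 * real (t * J) * real N) ^ (t * J))" using c0 by (simp add: mult_left_mono)
  have "c * (2 * real (t * J) * real N) ^ (t * J) = ((g / \<theta>) * ((2 / N)\<^sup>2 * (2 * real (t * J) * real N)) ^ t) ^ J"
  proof -
    have "(g / \<theta>) ^ J * x ^ (2 * t * J) * y ^ (t * J) = ((g / \<theta>) * (x\<^sup>2 * y) ^ t) ^ J" for x y :: real
      by (simp only: power_mult_distrib power_mult[symmetric] mult.assoc)
    then show ?thesis unfolding c_def .
  qed
  also have "(2 / N)\<^sup>2 * (2 * real (t * J) * real N) = 4 * J / g"
    using pos by (simp add: N_def power2_eq_square field_simps)
  also have "((g / \<theta>) * (4 * J / g) ^ t) ^ J \<le> (1 / 2) ^ J" using cond pos by (intro power_mono) auto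
  finally have "c * (2 * real (t * J) * real N) ^ (t * J) * 2 ^ N \<le> (1 / 2) ^ J * (2 ^ s * F)"
    using F by (intro mult_mono) auto
  also have "\<dots> = (2 ^ s / 2 ^ J) * F" by (simp add: power_one_over)
  also have "\<dots> \<le> 1 * F" using F0 sJ by (intro mult_right_mono) (auto simp: divide_le_eq_1)
  finally have "F * (c * (2 * real (t * J) * real N) ^ (t * J) * 2 ^ N) \<le> F * F" using F0 by (simp add: mult_left_mono)
  then have "c * (F * 2 ^ N * (2 * real (t * J) * real N) ^ (t * J)) \<le> F * F" by (simp add: mult_ac)
  then show ?thesis using 1 by (simp add: power2_eq_square)
qed

text \<open>The interpolation \<open>y\<^sup>j \<le> 1 + y\<^sup>J\<close> reduces all low levels to the single moment of order \<open>J\<close>.\<close>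

lemma low_levels:
  fixes t g J s :: nat and \<theta> :: real
  defines "N \<equiv> 2 * t * g"
  defines "I \<equiv> {..<N}"
  assumes pos: "t > 0" "g > 0" "0 < \<theta>" "\<theta> \<le> 1" and Jg: "2 * J \<le> g"
    and cond: "(g / \<theta>) * (4 * J / g) ^ t \<le> 1 / 2" and sJ: "s \<le> J"
    and h: "\<And>X. \<bar>h X\<bar> \<le> 1" and F: "F = (\<Sum>X\<in>Pow I. \<bar>h X\<bar>)" "2 ^ N \<le> 2 ^ s * F"
  shows "(\<Sum>V | V \<subseteq> {..<g} \<and> 0 < card V \<and> card V \<le> J.
            \<Sum>p | p permutes I. (coef I h (p ` blocks (2 * t) V))\<^sup>2) \<le> 4 * \<theta> * fact N * F\<^sup>2"
proof -
  define S where "S = {V. V \<subseteq> {..<g} \<and> 0 < card V \<and> card V \<le> J}"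
  have N: "N > 0" using pos by (simp add: N_def)
  have one: "(\<Sum>p | p permutes I. (coef I h (p ` blocks (2 * t) V))\<^sup>2) \<le> fact N * (2 * F\<^sup>2) * (\<theta> / g) ^ card V"
    if "V \<in> S" for V
  proof -
    define j where "j = card V"
    define l where "l = 2 * t * j"
    have V: "V \<subseteq> {..<g}" and j: "0 < j" "j \<le> J" using that by (auto simp: S_def j_def)
    have l: "card (blocks (2 * t) V) = l" using pos by (simp add: card_blocks l_def j_def)
    have "2 * j \<le> g" using j Jg by simp
    then have lN: "2 * l \<le> N" unfolding l_def N_def by (metis mult.left_commute mult_le_mono2)
    \<comment> \<open>With \<open>u\<close> the normalised correlation to the power
      \<open>2 * t\<close>, a set of \<open>j\<close> blocks contributes \<open>u ^ j\<close>.
      Scaling \<open>u\<close> by \<open>g / \<theta>\<close> before the interpolation leaves a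
      weight \<open>(\<theta> / g) ^ j\<close> that can be summed over all \<open>V\<close>.\<close>
    have bd: "\<bar>h X\<bar> * \<bar>h Y\<bar> * (2 / N * corr I X Y) ^ l \<le>
       (\<theta> / g) ^ j * (\<bar>h X\<bar> * \<bar>h Y\<bar> * (1 + (g / \<theta> * (2 / N * corr I X Y) ^ (2 * t)) ^ J))" for X Y
    proof -
      define u where "u = (2 / N * corr I X Y) ^ (2 * t)"
      have u: "u \<ge> 0" by (simp add: u_def zero_le_even_power)
      have "u ^ j = (\<theta> / g) ^ j * (g / \<theta> * u) ^ j" using pos by (simp flip: power_mult_distrib)
      also have "\<dots> \<le> (\<theta> / g) ^ j * (1 + (g / \<theta> * u) ^ J)"
        using pos u j by (intro mult_left_mono power_le_one_add_power) auto
      finally have "\<bar>h X\<bar> * \<bar>h Y\<bar> * u ^ j \<le> \<bar>h X\<bar> * \<bar>h Y\<bar> * ((\<theta> / g) ^ j * (1 + (g / \<theta> * u) ^ J))"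
        by (intro mult_left_mono) auto
      moreover have "(2 / N * corr I X Y) ^ l = u ^ j" unfolding u_def l_def by (simp add: power_mult)
      ultimately show ?thesis unfolding u_def by (simp add: mult_ac)
    qed
    have "(\<Sum>p | p permutes I. (coef I h (p ` blocks (2 * t) V))\<^sup>2) \<le>
       fact (N - l) * (\<Sum>X\<in>Pow I. \<Sum>Y\<in>Pow I. \<bar>h X\<bar> * \<bar>h Y\<bar> * corr I X Y ^ l)"
      using sum_permutations_coef_le[of I "blocks (2 * t) V" h] blocks_subset[OF V, of "2 * t"] pos l
      by (simp add: I_def N_def l_def)
    \<comment> \<open>The loss \<open>2 ^ l\<close> is absorbed by scaling the correlation with
      \<open>2 / N\<close> instead of \<open>1 / N\<close>.\<close>
    also have "\<dots> \<le> (2 ^ l * fact N / N ^ l) * (\<Sum>X\<in>Pow I. \<Sum>Y\<in>Pow I. \<bar>h X\<bar> * \<bar>h Y\<bar> * corr I X Y ^ l)"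
      using power_mult_fact_diff_le[OF lN] N
      by (intro mult_right_mono sum_nonneg) (auto simp: field_simps l_def zero_le_even_power)
    also have "\<dots> = fact N * (\<Sum>X\<in>Pow I. \<Sum>Y\<in>Pow I. \<bar>h X\<bar> * \<bar>h Y\<bar> * (2 / N * corr I X Y) ^ l)"
      by (simp add: sum_distrib_left power_mult_distrib power_divide mult_ac)
    also have "\<dots> \<le> fact N * (\<Sum>X\<in>Pow I. \<Sum>Y\<in>Pow I. (\<theta> / g) ^ j *
          (\<bar>h X\<bar> * \<bar>h Y\<bar> * (1 + (g / \<theta> * (2 / N * corr I X Y) ^ (2 * t)) ^ J)))"
      by (intro mult_left_mono sum_mono bd) auto
    also have "\<dots> = fact N * (\<theta> / g) ^ j * (\<Sum>X\<in>Pow I. \<Sum>Y\<in>Pow I.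
          (\<bar>h X\<bar> * \<bar>h Y\<bar> * (1 + (g / \<theta> * (2 / N * corr I X Y) ^ (2 * t)) ^ J)))"
      by (simp add: sum_distrib_left mult_ac)
    also have "\<dots> \<le> fact N * (\<theta> / g) ^ j * (2 * F\<^sup>2)"
      unfolding I_def N_def using pos j cond sJ h F
      by (intro mult_left_mono low_correlation_bound) (auto simp: I_def N_def)
    finally show ?thesis by (simp add: j_def mult_ac)
  qed
  have "(\<Sum>V\<in>S. (\<theta> / g) ^ card V) \<le> (\<Sum>V | V \<subseteq> {..<g} \<and> V \<noteq> {}. (\<theta> / g) ^ card V)"
    using pos by (intro sum_mono2) (auto simp: S_def)
  also have "\<dots> = (1 + \<theta> / g) ^ g - 1" by (subst sum_nonempty_power_card) auto
  also have "\<dots> \<le> exp (\<theta> / g) ^ g - 1" using pos exp_ge_add_one_self[of "\<theta> / g"]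
    by (intro diff_right_mono power_mono) auto
  also have "exp (\<theta> / g) ^ g = exp \<theta>" using pos by (simp flip: exp_of_nat_mult)
  also have "exp \<theta> - 1 \<le> 2 * \<theta>"
  proof -
    have "\<theta>\<^sup>2 \<le> \<theta>" using pos by (simp add: power2_eq_square mult_left_le)
    then show ?thesis using exp_bound[of \<theta>] pos by simp
  qed
  finally have sm: "(\<Sum>V\<in>S. (\<theta> / g) ^ card V) \<le> 2 * \<theta>" .
  have "(\<Sum>V\<in>S. \<Sum>p | p permutes I. (coef I h (p ` blocks (2 * t) V))\<^sup>2) \<le> (\<Sum>V\<in>S. fact N * (2 * F\<^sup>2) * (\<theta> / g) ^ card V)"
    by (intro sum_mono one)
  also have "\<dots> = fact N * (2 * F\<^sup>2) * (\<Sum>V\<in>S. (\<theta> / g) ^ card V)" by (simp add: sum_distrib_left)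
  also have "\<dots> \<le> fact N * (2 * F\<^sup>2) * (2 * \<theta>)" by (intro mult_left_mono sm) auto
  finally show ?thesis by (simp add: S_def mult_ac)
qed

section \<open>Unions of blocks of medium size\<close>

lemma ex_permutation_image_eq:
  assumes "finite I" "T \<subseteq> I" "T' \<subseteq> I" "card T = card T'"
  obtains q where "q permutes I" "q ` T = T'"
proof -
  have fin: "finite T" "finite T'" using assms finite_subset by auto
  obtain a where a: "bij_betw a T T'" using fin assms(4) by (metis finite_same_card_bij)
  have "card (I - T) = card (I - T')" using assms fin by (simp add: card_Diff_subset)
  then obtain b where b: "bij_betw b (I - T) (I - T')" using assms by (metis finite_Diff finite_same_card_bij)
  define q where "q x = (if x \<in> T then a x else if x \<in> I then b x else x)" for x
  have qT: "bij_betw q T T'" using a by (subst bij_betw_cong[of _ _ a]) (auto simp: q_def)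
  have "bij_betw q (I - T) (I - T')" using b by (subst bij_betw_cong[of _ _ b]) (auto simp: q_def)
  then have "bij_betw q (T \<union> (I - T)) (T' \<union> (I - T'))" by (intro bij_betw_combine qT) auto
  moreover have "T \<union> (I - T) = I" "T' \<union> (I - T') = I" using assms by auto
  ultimately have "q permutes I" using assms by (intro bij_imp_permutes) (auto simp: q_def)
  then show ?thesis using that qT by (auto simp: bij_betw_def)
qed

text \<open>The image of \<open>T\<close> under a random permutation is uniform among the subsets of
  its size: by transitivity \<open>T\<close> may be replaced by any such subset, and each
  permutation merely rearranges these subsets.\<close>

lemma sum_permutations_image:
  fixes H :: "nat set \<Rightarrow> real"
  assumes I: "finite I" and T: "T \<subseteq> I"
  shows "real (card I choose card T) * (\<Sum>p | p permutes I. H (p ` T)) = fact (card I) * (\<Sum>S | S \<subseteq> I \<and> card S = card T. H S)"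
proof -
  let ?C = "{S. S \<subseteq> I \<and> card S = card T}"
  have "(\<Sum>p | p permutes I. H (p ` S)) = (\<Sum>p | p permutes I. H (p ` T))" if "S \<in> ?C" for S
  proof -
    obtain q where q: "q permutes I" "q ` T = S"
      using ex_permutation_image_eq[OF I T, of S] \<open>S \<in> ?C\<close> by (metis (mono_tags, lifting) mem_Collect_eq)
    show ?thesis
      using sum_permutations_compose_right[OF q(1), of "\<lambda>p. H (p ` T)"] q(2)
      by (simp only: image_comp[symmetric])
  qed
  then have "real (card ?C) * (\<Sum>p | p permutes I. H (p ` T)) = (\<Sum>S\<in>?C. \<Sum>p | p permutes I. H (p ` S))" by simp
  also have "\<dots> = (\<Sum>p | p permutes I. \<Sum>S\<in>?C. H (p ` S))" by (rule sum.swap)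
  also have "\<dots> = (\<Sum>p | p permutes I. \<Sum>S\<in>?C. H S)"
  proof (rule sum.cong, simp, clarify)
    fix p assume p: "p permutes I"
    have "bij_betw ((`) p) ?C ?C"
    proof (rule bij_betwI[where g = "(`) (inv p)"])
      have *: "q ` S \<subseteq> I \<and> card (q ` S) = card T" if "q permutes I" "S \<subseteq> I" "card S = card T" for q S
        using that by (metis card_image image_mono permutes_image permutes_inj_on)
      show "(`) p \<in> ?C \<rightarrow> ?C" using *[OF p] by auto
      show "(`) (inv p) \<in> ?C \<rightarrow> ?C" using *[OF permutes_inv[OF p]] by auto
    qed (auto simp: image_comp permutes_inv_o[OF p])
    then show "(\<Sum>S\<in>?C. H (p ` S)) = (\<Sum>S\<in>?C. H S)" by (rule sum.reindex_bij_betw)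
  qed
  finally show ?thesis using I by (simp add: n_subsets card_permutations)
qed

lemma binomial_mult_le: "(a choose b) * (c choose d) \<le> (a + c) choose (b + d)"
proof -
  have "(a choose b) * (c choose (b + d - b)) \<le> (\<Sum>k\<le>b + d. (a choose k) * (c choose (b + d - k)))"
    by (rule member_le_sum) auto
  then show ?thesis by (simp add: vandermonde)
qed

text \<open>Choosing \<open>j\<close> elements from each of \<open>k\<close> disjoint sets of size
  \<open>g\<close> is one way to choose \<open>k * j\<close> elements from their union.\<close>

lemma binomial_power_le: "(g choose j) ^ k \<le> (k * g) choose (k * j)"
proof (induction k)
  case (Suc k)
  have "(g choose j) ^ Suc k \<le> (g choose j) * ((k * g) choose (k * j))" using Suc by simp
  also have "\<dots> \<le> (g + k * g) choose (j + k * j)" by (rule binomial_mult_le)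
  finally show ?case by simp
qed simp

lemma two_power_le_binomial:
  assumes "J \<le> j" "J + j \<le> g" shows "2 ^ J \<le> g choose j"
proof -
  have *: "2 ^ i \<le> g choose i" if "2 * i \<le> g" for i
  proof (cases "i = 0")
    case False
    then have "(2::real) ^ i \<le> (real g / real i) ^ i" using that by (intro power_mono) (auto simp: field_simps)
    also have "\<dots> \<le> real (g choose i)" using that by (intro binomial_ge_n_over_k_pow_k) simp
    finally show ?thesis by (metis of_nat_le_iff of_nat_numeral of_nat_power)
  qed simp
  show ?thesis
  proof (cases "2 * j \<le> g")
    case True
    then show ?thesis using *[of j] assms by (meson order_trans power_increasing one_le_numeral)
  next
    case False
    have "2 ^ J \<le> (2::nat) ^ (g - j)" using assms by (intro power_increasing) auto
    also have "\<dots> \<le> g choose (g - j)" using False by (intro *) simp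
    finally show ?thesis using assms by (metis add_leD2 binomial_symmetric)
  qed
qed

text \<open>For \<open>card V = j\<close> the average over \<open>p\<close> is the Fourier weight of
  level \<open>k * j\<close> divided by \<open>N choose (k * j)\<close>. There are
  \<open>g choose j\<close> such \<open>V\<close>, and as \<open>k \<ge> 2\<close> the quotient of
  the two binomial coefficients is at most \<open>1 / (g choose j)\<close>, hence at most
  \<open>1 / 2 ^ J\<close>. Parseval bounds the total weight by \<open>2 ^ N * F\<close>.\<close>

lemma mid_levels:
  fixes k g J s :: nat
  defines "N \<equiv> k * g"
  defines "I \<equiv> {..<N}"
  assumes k: "k \<ge> 2"
    and h: "\<And>X. \<bar>h X\<bar> \<le> 1" and F: "F = (\<Sum>X\<in>Pow I. \<bar>h X\<bar>)" "2 ^ N \<le> 2 ^ s * F"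
  shows "(\<Sum>V | V \<subseteq> {..<g} \<and> J \<le> card V \<and> J + card V \<le> g.
            \<Sum>p | p permutes I. (coef I h (p ` blocks k V))\<^sup>2) \<le> 2 ^ s / 2 ^ J * fact N * F\<^sup>2"
proof -
  define S where "S = {V. V \<subseteq> {..<g} \<and> J \<le> card V \<and> J + card V \<le> g}"
  define W where "W l = (\<Sum>T | T \<subseteq> I \<and> card T = l. (coef I h T)\<^sup>2)" for l
  have W0: "W l \<ge> 0" for l by (simp add: W_def sum_nonneg)
  have cI: "finite I" "card I = N" by (simp_all add: I_def)
  define Q where "Q j = fact N * W (k * j) / real (N choose (k * j))" for j
  have Q: "(\<Sum>p | p permutes I. (coef I h (p ` blocks k V))\<^sup>2) = Q (card V)" if "V \<in> S" for V
  proof -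
    have V: "V \<subseteq> {..<g}" using that by (simp add: S_def)
    have sub: "blocks k V \<subseteq> I" using blocks_subset[OF V, of k] k by (simp add: I_def N_def)
    have c: "card (blocks k V) = k * card V" using k by (simp add: card_blocks)
    have "k * card V \<le> N" using sub c by (metis cI card_mono)
    then have "real (N choose (k * card V)) > 0" by simp
    moreover have "real (N choose (k * card V)) * (\<Sum>p | p permutes I. (coef I h (p ` blocks k V))\<^sup>2) = fact N * W (k * card V)"
      using sum_permutations_image[OF cI(1) sub, of "\<lambda>T. (coef I h T)\<^sup>2"] by (simp add: c cI W_def)
    ultimately show ?thesis by (simp add: Q_def field_simps)
  qed
  let ?R = "{j. J \<le> j \<and> J + j \<le> g}"
  have finR: "finite ?R" by (rule finite_subset[of _ "{..g}"]) auto
  have "(\<Sum>V\<in>S. \<Sum>p | p permutes I. (coef I h (p ` blocks k V))\<^sup>2) = (\<Sum>V\<in>S. Q (card V))" by (simp add: Q)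
  also have "\<dots> = (\<Sum>j\<in>?R. \<Sum>V\<in>{V \<in> S. card V = j}. Q (card V))"
    using finR by (intro sum.group[symmetric]) (auto simp: S_def)
  also have "\<dots> = (\<Sum>j\<in>?R. real (g choose j) * Q j)"
  proof (rule sum.cong)
    fix j assume j: "j \<in> ?R"
    have "{V \<in> S. card V = j} = {V. V \<subseteq> {..<g} \<and> card V = j}" using j by (auto simp: S_def)
    then show "(\<Sum>V\<in>{V \<in> S. card V = j}. Q (card V)) = real (g choose j) * Q j" by (simp add: n_subsets)
  qed simp
  also have "\<dots> \<le> (\<Sum>j\<in>?R. fact N / 2 ^ J * W (k * j))"
  proof (rule sum_mono)
    fix j assume j: "j \<in> ?R"
    define b where "b = real (g choose j)"
    have b: "b \<ge> 2 ^ J" using two_power_le_binomial[of J j g] j unfolding b_def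
      by (metis (mono_tags) mem_Collect_eq of_nat_le_iff of_nat_numeral of_nat_power)
    then have b1: "b \<ge> 1" by (meson one_le_numeral one_le_power order_trans)
    have "b * b \<le> b ^ k" using b1 k power_increasing[of 2 k b] by (simp add: power2_eq_square)
    also have "\<dots> \<le> real (N choose (k * j))"
      unfolding b_def N_def using binomial_power_le[of g j k] by (metis of_nat_le_iff of_nat_power)
    finally have bb: "b * b \<le> real (N choose (k * j))" .
    have "1 \<le> b * b" using b1 mult_mono[of 1 b 1 b] by simp
    then have bpos: "0 < real (N choose (k * j))" "0 < b * b" using bb by linarith+
    have "b / real (N choose (k * j)) \<le> b / (b * b)" using bb b1 bpos by (intro divide_left_mono) auto
    also have "\<dots> = 1 / b" using b1 by simp
    also have "\<dots> \<le> 1 / 2 ^ J" using b b1 by (intro divide_left_mono) auto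
    finally have "b / real (N choose (k * j)) * (fact N * W (k * j)) \<le> 1 / 2 ^ J * (fact N * W (k * j))"
      using W0 by (intro mult_right_mono) auto
    then show "real (g choose j) * Q j \<le> fact N / 2 ^ J * W (k * j)" by (simp add: Q_def b_def)
  qed
  also have "\<dots> = fact N / 2 ^ J * (\<Sum>j\<in>?R. W (k * j))" by (simp add: sum_distrib_left)
  also have "(\<Sum>j\<in>?R. W (k * j)) = (\<Sum>l\<in>(\<lambda>j. k * j) ` ?R. W l)"
    using k by (subst sum.reindex) (auto simp: inj_on_def)
  also have "\<dots> \<le> (\<Sum>l\<in>{..N}. W l)"
    using W0 by (intro sum_mono2) (auto simp: N_def)
  also have "\<dots> = (\<Sum>l\<in>{..N}. \<Sum>T\<in>{T \<in> Pow I. card T = l}. (coef I h T)\<^sup>2)" by (simp add: W_def)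
  also have "\<dots> = (\<Sum>T\<in>Pow I. (coef I h T)\<^sup>2)"
    using cI card_mono by (intro sum.group) fastforce+
  also have "\<dots> = 2 ^ N * (\<Sum>X\<in>Pow I. (h X)\<^sup>2)" using parseval[OF cI(1)] cI by simp
  also have "(\<Sum>X\<in>Pow I. (h X)\<^sup>2) \<le> F" unfolding F
  proof (rule sum_mono)
    fix X show "(h X)\<^sup>2 \<le> \<bar>h X\<bar>" using h[of X] mult_left_le[of "\<bar>h X\<bar>" "\<bar>h X\<bar>"] by (simp add: power2_eq_square)
  qed
  also have "2 ^ N * F \<le> 2 ^ s * F * F" using F by (intro mult_right_mono) (auto simp: sum_nonneg)
  finally have "(\<Sum>V\<in>S. \<Sum>p | p permutes I. (coef I h (p ` blocks k V))\<^sup>2) \<le> fact N / 2 ^ J * (2 ^ s * F * F)"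
    by (simp add: mult_left_mono divide_right_mono)
  then show ?thesis by (simp add: S_def power2_eq_square mult_ac)
qed

section \<open>Advantage of a one-way message\<close>

text \<open>As \<open>g\<close> is even, an odd \<open>card V\<close> excludes both the empty set
  and \<open>{..<g}\<close>. So \<open>V\<close> is nonempty and small, of medium size, or the
  complement of a nonempty small set; for the last kind the bound on low levels is applied to
  \<open>h\<close> times \<open>chi I\<close>.\<close>

lemma odd_levels:
  fixes t g J s :: nat and \<theta> :: real
  defines "N \<equiv> 2 * t * g"
  defines "I \<equiv> {..<N}"
  assumes pos: "t > 0" "g > 0" "0 < \<theta>" "\<theta> \<le> 1" and g: "even g" and Jg: "2 * J \<le> g"
    and cond: "(g / \<theta>) * (4 * J / g) ^ t \<le> 1 / 2" and sJ: "s \<le> J"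
    and h: "\<And>X. \<bar>h X\<bar> \<le> 1" and F: "F = (\<Sum>X\<in>Pow I. \<bar>h X\<bar>)" "2 ^ N \<le> 2 ^ s * F"
  shows "(\<Sum>V | V \<subseteq> {..<g} \<and> odd (card V). \<Sum>p | p permutes I. (coef I h (p ` blocks (2 * t) V))\<^sup>2)
           \<le> (8 * \<theta> + 2 ^ s / 2 ^ J) * fact N * F\<^sup>2"
proof -
  define H where "H h V = (\<Sum>p | p permutes I. (coef I h (p ` blocks (2 * t) V))\<^sup>2)" for h V
  define A where "A = {V. V \<subseteq> {..<g} \<and> 0 < card V \<and> card V \<le> J}"
  define B where "B = {V. V \<subseteq> {..<g} \<and> J \<le> card V \<and> J + card V \<le> g}"
  define C where "C = (\<lambda>V. {..<g} - V) ` A"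
  have H0: "H h V \<ge> 0" for h V by (simp add: H_def sum_nonneg)
  have fin: "finite A" "finite B" "finite C" by (auto simp: A_def B_def C_def)
  have sub: "{V. V \<subseteq> {..<g} \<and> odd (card V)} \<subseteq> A \<union> B \<union> C"
  proof
    fix V assume "V \<in> {V. V \<subseteq> {..<g} \<and> odd (card V)}"
    then have V: "V \<subseteq> {..<g}" "odd (card V)" by auto
    have cc: "card ({..<g} - V) = g - card V" using V(1) by (simp add: card_Diff_subset finite_subset)
    have "card V \<le> g" using V(1) card_mono[of "{..<g}" V] by simp
    moreover have "card V \<noteq> g" "card V \<noteq> 0" using V(2) g by (metis even_zero)+
    moreover have "V = {..<g} - ({..<g} - V)" using V(1) by auto
    then have "V \<in> C" if "{..<g} - V \<in> A" using that unfolding C_def by blast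
    moreover consider "card V \<le> J" | "J \<le> card V" "J + card V \<le> g" | "g - card V \<le> J" by linarith
    ultimately show "V \<in> A \<union> B \<union> C" using V(1) cc by cases (auto simp: A_def B_def)
  qed
  have "(\<Sum>V | V \<subseteq> {..<g} \<and> odd (card V). H h V) \<le> (\<Sum>V\<in>A \<union> B \<union> C. H h V)"
    using fin sub H0 by (intro sum_mono2) auto
  also have "\<dots> \<le> (\<Sum>V\<in>A. H h V) + (\<Sum>V\<in>B. H h V) + (\<Sum>V\<in>C. H h V)"
  proof -
    have "(\<Sum>V\<in>A \<union> B \<union> C. H h V) \<le> (\<Sum>V\<in>A \<union> B. H h V) + (\<Sum>V\<in>C. H h V)"
      using fin H0 by (simp add: sum_Un sum_nonneg)
    moreover have "(\<Sum>V\<in>A \<union> B. H h V) \<le> (\<Sum>V\<in>A. H h V) + (\<Sum>V\<in>B. H h V)"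
      using fin H0 by (simp add: sum_Un sum_nonneg)
    ultimately show ?thesis by linarith
  qed
  also have "(\<Sum>V\<in>A. H h V) \<le> 4 * \<theta> * fact N * F\<^sup>2"
    unfolding A_def H_def N_def I_def using pos Jg cond sJ h F by (intro low_levels[where s = s]) (auto simp: N_def I_def)
  also have "(\<Sum>V\<in>B. H h V) \<le> 2 ^ s / 2 ^ J * fact N * F\<^sup>2"
    unfolding B_def H_def N_def I_def using pos h F by (intro mid_levels) (auto simp: N_def I_def)
  also have "(\<Sum>V\<in>C. H h V) = (\<Sum>V\<in>A. H h ({..<g} - V))"
    unfolding C_def by (subst sum.reindex) (auto simp: A_def inj_on_def)
  also have "\<dots> = (\<Sum>V\<in>A. H (\<lambda>X. h X * chi I X) V)"
  proof (rule sum.cong)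
    fix V assume "V \<in> A"
    then have V: "V \<subseteq> {..<g}" by (simp add: A_def)
    show "H h ({..<g} - V) = H (\<lambda>X. h X * chi I X) V" unfolding H_def
    proof (rule sum.cong, simp, clarify)
      fix p assume p: "p permutes I"
      have sub: "blocks (2 * t) V \<subseteq> I" using blocks_subset[OF V] pos by (simp add: I_def N_def)
      have "p ` blocks (2 * t) ({..<g} - V) = p ` (I - blocks (2 * t) V)"
        using blocks_compl[of "2 * t" g V] pos by (simp add: I_def N_def)
      also have "\<dots> = I - p ` blocks (2 * t) V"
        using p by (metis image_set_diff permutes_image permutes_inj)
      finally show "(coef I h (p ` blocks (2 * t) ({..<g} - V)))\<^sup>2 = (coef I (\<lambda>X. h X * chi I X) (p ` blocks (2 * t) V))\<^sup>2"
        using coef_complement[of I "p ` blocks (2 * t) V" h] sub p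
        by (metis I_def finite_lessThan image_mono permutes_image)
    qed
  qed simp
  also have "\<dots> \<le> 4 * \<theta> * fact N * F\<^sup>2"
    unfolding A_def H_def N_def I_def using pos Jg cond sJ h F
    by (intro low_levels[where s = s]) (auto simp: N_def I_def abs_mult)
  finally show ?thesis by (simp add: H_def algebra_simps)
qed

section \<open>Block parities and the advantage for a fixed permutation\<close>

definition parset :: "nat \<Rightarrow> nat \<Rightarrow> (nat \<Rightarrow> nat) \<Rightarrow> nat set \<Rightarrow> nat set" where
  "parset k g p X = {j. j < g \<and> odd (card {r. r < k \<and> p (j * k + r) \<in> X})}"

lemma prod_sgn_at_eq:
  assumes "finite R" shows "(\<Prod>r\<in>R. sgn_at (q r) X) = (if odd (card {r \<in> R. q r \<in> X}) then - 1 else 1)"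
proof -
  have "(\<Prod>r\<in>R. sgn_at (q r) X) = (\<Prod>r\<in>{r \<in> R. q r \<in> X}. - 1)"
    unfolding sgn_at_def using assms by (subst prod.inter_filter) auto
  then show ?thesis by simp
qed

text \<open>The sign of a block parity is the product of the signs of its bits, so a character in
  the block parities is a character in the hidden bits.\<close>

lemma chi_parset:
  assumes k: "k > 0" and V: "V \<subseteq> {..<g}" and p: "inj p"
  shows "chi V (parset k g p X) = chi (p ` blocks k V) X"
proof -
  have "chi (p ` blocks k V) X = (\<Prod>i\<in>blocks k V. sgn_at (p i) X)"
    unfolding chi_def using p by (subst prod.reindex) (auto intro: inj_on_subset)
  also have "\<dots> = (\<Prod>(j, r)\<in>V \<times> {..<k}. sgn_at (p (j * k + r)) X)"
    unfolding blocks_eq_image[OF k] by (subst prod.reindex[OF inj_on_block_index[OF k]]) (simp add: case_prod_unfold)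
  also have "\<dots> = (\<Prod>j\<in>V. \<Prod>r<k. sgn_at (p (j * k + r)) X)" by (simp add: prod.cartesian_product)
  also have "\<dots> = (\<Prod>j\<in>V. sgn_at j (parset k g p X))"
  proof (rule prod.cong)
    fix j assume "j \<in> V"
    then have "j < g" using V by auto
    then show "(\<Prod>r<k. sgn_at (p (j * k + r)) X) = sgn_at j (parset k g p X)"
      unfolding prod_sgn_at_eq[OF finite_lessThan] by (auto simp: sgn_at_def parset_def)
  qed simp
  finally show ?thesis by (simp add: chi_def)
qed

lemma chi_compl:
  assumes "finite G" "V \<subseteq> G" shows "chi V (G - W) = (-1) ^ card V * chi V W"
proof -
  have "chi V (G - W) = (\<Prod>i\<in>V. (-1) * sgn_at i W)"
    unfolding chi_def using assms by (intro prod.cong) (auto simp: sgn_at_def)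
  then show ?thesis by (simp only: chi_def prod.distrib prod_constant)
qed

text \<open>Let \<open>d\<close> be the difference of the push-forwards of \<open>f\<close> to the
  two values of \<open>W\<close>. Its coefficient at \<open>V\<close> is
  \<open>(-1) ^ card V - 1\<close> times a coefficient of \<open>f\<close>, so only odd
  \<open>V\<close> survive, with a factor 4 after squaring. Cauchy-Schwarz against \<open>B\<close>
  costs \<open>2 ^ g\<close>, which Parseval for \<open>d\<close> absorbs.\<close>

lemma advantage_fixed_matching:
  fixes B :: "nat set \<Rightarrow> real" and g :: nat
  defines "G \<equiv> {..<g}"
  assumes k: "k > 0" and p: "inj p" and B: "\<And>W. \<bar>B W\<bar> \<le> 1" and I: "finite I"
  shows "(\<Sum>X\<in>Pow I. f X * (B (G - parset k g p X) - B (parset k g p X)))\<^sup>2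
           \<le> 4 * (\<Sum>V | V \<subseteq> G \<and> odd (card V). (coef I f (p ` blocks k V))\<^sup>2)"
proof -
  define P where "P X = parset k g p X" for X
  define d where "d W = (\<Sum>X | X \<in> Pow I \<and> G - P X = W. f X) - (\<Sum>X | X \<in> Pow I \<and> P X = W. f X)" for W
  have G: "finite G" "card G = g" by (simp_all add: G_def)
  have PG: "P X \<in> Pow G" for X by (auto simp: P_def parset_def G_def)
  have push: "(\<Sum>W\<in>Pow G. c W * d W) = (\<Sum>X\<in>Pow I. f X * (c (G - P X) - c (P X)))" for c
  proof -
    have *: "(\<Sum>W\<in>Pow G. c W * (\<Sum>X | X \<in> Pow I \<and> Q X = W. f X)) = (\<Sum>X\<in>Pow I. f X * c (Q X))"
      if "\<And>X. Q X \<in> Pow G" for Q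
    proof -
      have "(\<Sum>W\<in>Pow G. c W * (\<Sum>X | X \<in> Pow I \<and> Q X = W. f X)) = (\<Sum>W\<in>Pow G. \<Sum>X | X \<in> Pow I \<and> Q X = W. f X * c (Q X))"
        unfolding sum_distrib_left by (intro sum.cong) auto
      also have "\<dots> = (\<Sum>X\<in>Pow I. f X * c (Q X))" using G I that by (intro sum.group) auto
      finally show ?thesis .
    qed
    have "(\<Sum>W\<in>Pow G. c W * d W) = (\<Sum>X\<in>Pow I. f X * c (G - P X)) - (\<Sum>X\<in>Pow I. f X * c (P X))"
      unfolding d_def right_diff_distrib sum_subtractf using *[of "\<lambda>X. G - P X"] *[of P] PG by simp
    then show ?thesis by (simp add: right_diff_distrib sum_subtractf)
  qed
  have coefd: "(coef G d V)\<^sup>2 = (if odd (card V) then 4 * (coef I f (p ` blocks k V))\<^sup>2 else 0)" if V: "V \<in> Pow G" for V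
  proof -
    have "coef G d V = (\<Sum>X\<in>Pow I. f X * (chi V (G - P X) - chi V (P X)))"
      unfolding coef_def using push[of "chi V"] by (simp add: mult.commute)
    also have "\<dots> = (\<Sum>X\<in>Pow I. ((-1) ^ card V - 1) * (f X * chi (p ` blocks k V) X))"
      using V G chi_parset[OF k _ p, of V g] by (intro sum.cong) (auto simp: chi_compl P_def G_def algebra_simps)
    also have "\<dots> = ((-1) ^ card V - 1) * coef I f (p ` blocks k V)" by (simp add: coef_def sum_distrib_left)
    finally show ?thesis by (auto simp: power_mult_distrib)
  qed
  have "(\<Sum>X\<in>Pow I. f X * (B (G - P X) - B (P X)))\<^sup>2 = (\<Sum>W\<in>Pow G. B W * d W)\<^sup>2" by (simp add: push)
  also have "\<dots> \<le> (\<Sum>W\<in>Pow G. (B W)\<^sup>2) * (\<Sum>W\<in>Pow G. (d W)\<^sup>2)" by (rule Cauchy_Schwarz_ineq_sum)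
  also have "\<dots> \<le> 2 ^ card G * (\<Sum>W\<in>Pow G. (d W)\<^sup>2)"
  proof (rule mult_right_mono)
    have "(\<Sum>W\<in>Pow G. (B W)\<^sup>2) \<le> (\<Sum>W\<in>Pow G. 1)" using B by (intro sum_mono) (simp add: abs_square_le_1)
    then show "(\<Sum>W\<in>Pow G. (B W)\<^sup>2) \<le> 2 ^ card G" using G by (simp add: card_Pow)
  qed (simp add: sum_nonneg)
  also have "\<dots> = (\<Sum>V\<in>Pow G. (coef G d V)\<^sup>2)" using parseval[OF G(1), of d] by simp
  also have "\<dots> = (\<Sum>V\<in>Pow G. if odd (card V) then 4 * (coef I f (p ` blocks k V))\<^sup>2 else 0)" by (simp add: coefd)
  also have "\<dots> = (\<Sum>V\<in>{V \<in> Pow G. odd (card V)}. 4 * (coef I f (p ` blocks k V))\<^sup>2)"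
    using G by (intro sum.inter_filter[symmetric]) simp
  finally show ?thesis by (simp add: P_def sum_distrib_left)
qed

text \<open>Cauchy-Schwarz over the permutations reduces the claim to squared advantages, to which
  the bound for a fixed permutation and then the bound on odd levels apply.\<close>

lemma advantage_heavy_message:
  fixes t g J s :: nat and \<theta> :: real and f :: "nat set \<Rightarrow> real"
  defines "N \<equiv> 2 * t * g"
  defines "I \<equiv> {..<N}"
  assumes pos: "t > 0" "g > 0" "0 < \<theta>" "\<theta> \<le> 1" and g: "even g" and Jg: "2 * J \<le> g"
    and cond: "(g / \<theta>) * (4 * J / g) ^ t \<le> 1 / 2" and sJ: "s \<le> J"
    and f: "\<And>X. 0 \<le> f X" "\<And>X. f X \<le> 1" and F: "F = (\<Sum>X\<in>Pow I. f X)" "2 ^ N \<le> 2 ^ s * F"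
    and B: "\<And>p W. \<bar>B p W\<bar> \<le> 1"
  shows "(\<Sum>p | p permutes I. \<Sum>X\<in>Pow I. f X * (B p ({..<g} - parset (2 * t) g p X) - B p (parset (2 * t) g p X)))
           \<le> 2 * sqrt (8 * \<theta> + 2 ^ s / 2 ^ J) * fact N * F"
proof -
  define a where "a p = (\<Sum>X\<in>Pow I. f X * (B p ({..<g} - parset (2 * t) g p X) - B p (parset (2 * t) g p X)))" for p
  define S where "S = {p. p permutes I}"
  have S: "card S = fact N" "finite S" by (simp_all add: S_def I_def card_permutations finite_permutations)
  have F0: "F \<ge> 0" unfolding F using f by (simp add: sum_nonneg)
  have "(\<Sum>p\<in>S. a p)\<^sup>2 \<le> (\<Sum>p\<in>S. 1\<^sup>2) * (\<Sum>p\<in>S. (a p)\<^sup>2)" using Cauchy_Schwarz_ineq_sum[of "\<lambda>_. 1" a S] by simp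
  also have "\<dots> \<le> fact N * (\<Sum>p\<in>S. 4 * (\<Sum>V | V \<subseteq> {..<g} \<and> odd (card V). (coef I f (p ` blocks (2 * t) V))\<^sup>2))"
    unfolding a_def using S pos B
    by (auto intro!: mult_mono sum_mono sum_nonneg advantage_fixed_matching simp: S_def permutes_inj I_def)
  also have "\<dots> = 4 * fact N * (\<Sum>V | V \<subseteq> {..<g} \<and> odd (card V). \<Sum>p\<in>S. (coef I f (p ` blocks (2 * t) V))\<^sup>2)"
    by (subst sum.swap) (simp add: sum_distrib_left mult_ac)
  also have "\<dots> \<le> 4 * fact N * ((8 * \<theta> + 2 ^ s / 2 ^ J) * fact N * F\<^sup>2)"
    unfolding S_def I_def N_def using pos g Jg cond sJ f F
    by (intro mult_left_mono odd_levels) (auto simp: I_def N_def)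
  also have "\<dots> = (2 * sqrt (8 * \<theta> + 2 ^ s / 2 ^ J) * fact N * F)\<^sup>2"
    using pos by (simp add: power_mult_distrib) (simp add: power2_eq_square)
  finally have "(\<Sum>p\<in>S. a p)\<^sup>2 \<le> (2 * sqrt (8 * \<theta> + 2 ^ s / 2 ^ J) * fact N * F)\<^sup>2" .
  then have "(\<Sum>p\<in>S. a p) \<le> 2 * sqrt (8 * \<theta> + 2 ^ s / 2 ^ J) * fact N * F"
    by (rule power2_le_imp_le) (use F0 pos in simp)
  then show ?thesis by (simp add: a_def S_def)
qed

text \<open>Messages are split by their weight \<open>F m\<close>. The advantage of a heavy one is a
  small fraction of its weight, and the weights sum to \<open>2 ^ N\<close>. The advantage of a
  light one is at most its weight per permutation, which is below
  \<open>2 ^ N / 2 ^ s\<close>.\<close>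

lemma advantage_protocol:
  fixes t g J s :: nat and \<theta> :: real and f :: "'m \<Rightarrow> nat set \<Rightarrow> real"
  defines "N \<equiv> 2 * t * g"
  defines "I \<equiv> {..<N}"
  assumes pos: "t > 0" "g > 0" "0 < \<theta>" "\<theta> \<le> 1" and g: "even g" and Jg: "2 * J \<le> g"
    and cond: "(g / \<theta>) * (4 * J / g) ^ t \<le> 1 / 2" and sJ: "s \<le> J"
    and M: "finite M" and f: "\<And>m X. 0 \<le> f m X" "\<And>m X. f m X \<le> 1" "\<And>X. X \<in> Pow I \<Longrightarrow> (\<Sum>m\<in>M. f m X) = 1"
    and B: "\<And>m p W. 0 \<le> B m p W" "\<And>m p W. B m p W \<le> 1"
  shows "(\<Sum>m\<in>M. \<Sum>p | p permutes I. \<Sum>X\<in>Pow I. f m X *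
              (B m p ({..<g} - parset (2 * t) g p X) - B m p (parset (2 * t) g p X)))
           \<le> (card M / 2 ^ s + 2 * sqrt (8 * \<theta> + 2 ^ s / 2 ^ J)) * fact N * 2 ^ N"
proof -
  define a where "a m = (\<Sum>p | p permutes I. \<Sum>X\<in>Pow I. f m X *
              (B m p ({..<g} - parset (2 * t) g p X) - B m p (parset (2 * t) g p X)))" for m
  define F where "F m = (\<Sum>X\<in>Pow I. f m X)" for m
  define \<epsilon> where "\<epsilon> = 2 * sqrt (8 * \<theta> + 2 ^ s / 2 ^ J)"
  have \<epsilon>: "\<epsilon> \<ge> 0" using pos by (simp add: \<epsilon>_def)
  have F0: "F m \<ge> 0" for m unfolding F_def using f by (simp add: sum_nonneg)
  have am: "a m \<le> fact N * 2 ^ N / 2 ^ s + \<epsilon> * fact N * F m" for m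
  proof (cases "2 ^ N \<le> 2 ^ s * F m")
    case True
    have Babs: "\<bar>B m p W\<bar> \<le> 1" for p W using B[of m p W] by simp
    have "a m \<le> \<epsilon> * fact N * F m" unfolding a_def \<epsilon>_def I_def N_def
      using pos g Jg cond sJ f True Babs
      by (intro advantage_heavy_message) (auto simp: F_def I_def N_def)
    then show ?thesis by (simp add: add_increasing)
  next
    case False
    have "a m \<le> (\<Sum>p | p permutes I. \<Sum>X\<in>Pow I. f m X * 1)"
      unfolding a_def
    proof (intro sum_mono mult_left_mono f)
      fix p X show "B m p ({..<g} - parset (2 * t) g p X) - B m p (parset (2 * t) g p X) \<le> 1"
        using B(2)[of m p "{..<g} - parset (2 * t) g p X"] B(1)[of m p "parset (2 * t) g p X"] by linarith
    qed
    also have "\<dots> = fact N * F m" by (simp add: F_def I_def card_permutations)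
    also have "\<dots> \<le> fact N * (2 ^ N / 2 ^ s)" using False by (intro mult_left_mono) (auto simp: field_simps)
    finally show ?thesis using \<epsilon> F0 by (simp add: add_increasing2)
  qed
  have "(\<Sum>m\<in>M. F m) = (\<Sum>X\<in>Pow I. \<Sum>m\<in>M. f m X)" unfolding F_def by (rule sum.swap)
  also have "\<dots> = 2 ^ N" using f(3) by (simp add: I_def card_Pow)
  finally have sF: "(\<Sum>m\<in>M. F m) = 2 ^ N" .
  have "(\<Sum>m\<in>M. a m) \<le> (\<Sum>m\<in>M. fact N * 2 ^ N / 2 ^ s + \<epsilon> * fact N * F m)" by (intro sum_mono am)
  also have "\<dots> = card M * (fact N * 2 ^ N / 2 ^ s) + \<epsilon> * fact N * 2 ^ N"
    by (simp add: sum.distrib sum_distrib_left[symmetric] sF)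
  finally show ?thesis by (simp add: a_def \<epsilon>_def algebra_simps)
qed

section \<open>The streams\<close>

text \<open>Gadget \<open>i\<close> owns the four numbers from \<open>4 * i\<close> on; two closing
  vertices per block follow after \<open>4 * N\<close>. With \<open>N = k * g\<close> these are
  exactly the numbers below \<open>(4 * k + 2) * g\<close>.\<close>

definition upper :: "nat \<Rightarrow> bool \<Rightarrow> nat" where "upper i a = 4 * i + of_bool a"
definition lower :: "nat \<Rightarrow> bool \<Rightarrow> nat" where "lower i a = 4 * i + 2 + of_bool a"
definition extra :: "nat \<Rightarrow> nat \<Rightarrow> bool \<Rightarrow> nat" where "extra N j a = 4 * N + 2 * j + of_bool a"

definition alice :: "nat \<Rightarrow> nat set \<Rightarrow> nat set list" where
  "alice N X = map (\<lambda>(i, a). {upper i a, lower i (a \<noteq> (i \<in> X))}) (List.product [0..<N] [False, True])"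

text \<open>The closing vertices give each strand the odd number \<open>2 * k + 1\<close> of
  vertices: strands closed separately are odd cycles, and two strands closed into one form an even
  cycle.\<close>

definition bob :: "nat \<Rightarrow> nat \<Rightarrow> (nat \<Rightarrow> nat) \<Rightarrow> nat set \<Rightarrow> nat set list" where
  "bob k g p W =
     map (\<lambda>((j, r), a). {lower (p (j * k + r)) a,
                        if Suc r < k then upper (p (j * k + Suc r)) a else extra (k * g) j a})
         (List.product (List.product [0..<g] [0..<k]) [False, True]) @
     map (\<lambda>(j, a). {extra (k * g) j a, upper (p (j * k)) (a \<noteq> (j \<in> W))}) (List.product [0..<g] [False, True])"

text \<open>Tells whether the first \<open>r\<close> gadgets of block \<open>j\<close> have
  exchanged the two sides, hence on which side a strand arrives at the next gadget.\<close>

definition par_upto :: "nat \<Rightarrow> (nat \<Rightarrow> nat) \<Rightarrow> nat set \<Rightarrow> nat \<Rightarrow> nat \<Rightarrow> bool" where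
  "par_upto k p X j r = odd (card {i. i < r \<and> p (j * k + i) \<in> X})"

text \<open>Block \<open>j\<close> carries two strands, indexed by \<open>b\<close>; \<open>strand k g p X j b r\<close> is the vertex
  at position \<open>r \<le> 2 * k\<close> of the strand that starts at \<open>upper (p (j * k)) b\<close>.\<close>

definition strand :: "nat \<Rightarrow> nat \<Rightarrow> (nat \<Rightarrow> nat) \<Rightarrow> nat set \<Rightarrow> nat \<Rightarrow> bool \<Rightarrow> nat \<Rightarrow> nat" where
  "strand k g p X j b r =
     (if r = 2 * k then extra (k * g) j (b \<noteq> par_upto k p X j k)
      else if even r then upper (p (j * k + r div 2)) (b \<noteq> par_upto k p X j (r div 2))
      else lower (p (j * k + r div 2)) (b \<noteq> par_upto k p X j (Suc (r div 2))))"

text \<open>Strands are laid out one after the other, the two strands of a block being adjacent. Cut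
  into intervals of length \<open>2 * k + 1\<close> the positions give single strands, cut into
  length \<open>4 * k + 2\<close> whole blocks, so one layout serves both values of
  \<open>W\<close>.\<close>

definition layout :: "nat \<Rightarrow> nat \<Rightarrow> (nat \<Rightarrow> nat) \<Rightarrow> nat set \<Rightarrow> nat \<Rightarrow> nat" where
  "layout k g p X q = strand k g p X (q div (2 * k + 1) div 2) (odd (q div (2 * k + 1))) (q mod (2 * k + 1))"

lemma length_alice: "length (alice N X) = 2 * N"
  by (simp add: alice_def)

lemma length_bob: "length (bob k g p W) = 2 * k * g + 2 * g"
  by (simp add: bob_def mult_ac)

lemma par_upto_0 [simp]: "par_upto k p X j 0 = False"
  by (simp add: par_upto_def)

lemma par_upto_Suc: "par_upto k p X j (Suc r) = (par_upto k p X j r \<noteq> (p (j * k + r) \<in> X))"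
proof -
  have "{i. i < Suc r \<and> p (j * k + i) \<in> X} =
      (if p (j * k + r) \<in> X then insert r {i. i < r \<and> p (j * k + i) \<in> X} else {i. i < r \<and> p (j * k + i) \<in> X})"
    by (auto simp: less_Suc_eq)
  then show ?thesis by (simp add: par_upto_def)
qed

lemma mem_parset_iff: "j < g \<Longrightarrow> j \<in> parset k g p X \<longleftrightarrow> par_upto k p X j k"
  by (simp add: parset_def par_upto_def)

lemma layout_strand:
  assumes "r < 2 * k + 1"
  shows "layout k g p X ((2 * j + of_bool b) * (2 * k + 1) + r) = strand k g p X j b r"
proof -
  have "((2 * j + of_bool b) * (2 * k + 1) + r) div (2 * k + 1) = 2 * j + of_bool b"
    using assms by (intro div_nat_eqI) (auto simp: algebra_simps)
  moreover have "((2 * j + of_bool b) * (2 * k + 1) + r) mod (2 * k + 1) = r"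
    using assms by (metis mod_less mod_mult_self3)
  ultimately show ?thesis by (simp add: layout_def)
qed

lemma position_exists:
  fixes q k g :: nat
  assumes "q < (4 * k + 2) * g"
  obtains j b r where "j < g" "r < 2 * k + 1" "q = (2 * j + of_bool b) * (2 * k + 1) + r"
proof
  let ?s = "q div (2 * k + 1)"
  have "q < (2 * g) * (2 * k + 1)" using assms by (simp add: algebra_simps)
  then have "?s < 2 * g" by (simp add: div_less_iff_less_mult)
  then show "?s div 2 < g" by simp
  show "q mod (2 * k + 1) < 2 * k + 1" by simp
  have "2 * (?s div 2) + of_bool (odd ?s) = ?s" by simp
  then show "q = (2 * (?s div 2) + of_bool (odd ?s)) * (2 * k + 1) + q mod (2 * k + 1)"
    by (metis div_mult_mod_eq)
qed

lemma position_less: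
  fixes j k g r :: nat
  assumes "j < g" "r < 2 * k + 1"
  shows "(2 * j + of_bool b) * (2 * k + 1) + r < (4 * k + 2) * g"
proof -
  have "(2 * j + of_bool b) * (2 * k + 1) + r < (2 * j + of_bool b + 1) * (2 * k + 1)" using assms(2) by simp
  also have "\<dots> \<le> (2 * g) * (2 * k + 1)" using assms(1) by (intro mult_le_mono1) auto
  finally show ?thesis by (simp add: algebra_simps)
qed

text \<open>It suffices to locate every vertex on some strand; injectivity and the equality of the
  sets then follow by counting.\<close>

lemma layout_bij:
  assumes p: "p permutes {..<k * g}" and k: "k > 0"
  shows "inj_on (layout k g p X) {..<(4 * k + 2) * g} \<and> layout k g p X ` {..<(4 * k + 2) * g} = {..<(4 * k + 2) * g}"
proof -
  let ?A = "{..<(4 * k + 2) * g}" and ?f = "layout k g p X"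
  have surj: "?A \<subseteq> ?f ` ?A"
  proof
    fix v assume v: "v \<in> ?A"
    have in_image: "v \<in> ?f ` ?A" if "j < g" "r < 2 * k + 1" "v = strand k g p X j b r" for j r b
      using that position_less[of j g r k b] layout_strand[of r k g p X j b] by (metis image_eqI lessThan_iff)
    show "v \<in> ?f ` ?A"
    proof (cases "v < 4 * (k * g)")
      case True
      then have "v div 4 < k * g" by simp
      then obtain i where i: "i < k * g" "v div 4 = p i" using p by (metis imageE lessThan_iff permutes_image)
      define j where "j = i div k"
      define r where "r = i mod k"
      have jr: "j < g" "r < k" "j * k + r = i" using i k by (auto simp: j_def r_def div_less_iff_less_mult mult.commute)
      have v4: "v = 4 * p i + v mod 4" using i by (metis mult_div_mod_eq)
      show ?thesis
      proof (cases "v mod 4 < 2")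
        case True
        then have "v = upper (p i) (v mod 4 = 1)" using v4 by (auto simp: upper_def less_2_cases_iff)
        \<comment> \<open>The strand is chosen so that, after the exchanges before gadget
          \<open>r\<close>, it is on the side of \<open>v\<close>.\<close>
        moreover define b where "b = ((v mod 4 = 1) \<noteq> par_upto k p X j r)"
        then have "(b \<noteq> par_upto k p X j r) = (v mod 4 = 1)" by auto
        ultimately have "v = strand k g p X j b (2 * r)" using jr by (simp add: strand_def)
        then show ?thesis using jr by (intro in_image) auto
      next
        case False
        then have "v mod 4 = 2 \<or> v mod 4 = 3" using mod_less_divisor[of 4 v] by linarith
        then have "v = lower (p i) (v mod 4 = 3)" using v4 by (auto simp: lower_def)
        moreover define b where "b = ((v mod 4 = 3) \<noteq> par_upto k p X j (Suc r))"
        then have "(b \<noteq> par_upto k p X j (Suc r)) = (v mod 4 = 3)" by auto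
        moreover have "2 * r + 1 \<noteq> 2 * k" by presburger
        ultimately have "v = strand k g p X j b (2 * r + 1)" using jr by (simp add: strand_def)
        then show ?thesis using jr by (intro in_image) auto
      qed
    next
      case False
      define y where "y = v - 4 * (k * g)"
      have y: "v = 4 * (k * g) + y" "y < 2 * g" using v False by (auto simp: y_def algebra_simps)
      define b where "b = (odd y \<noteq> par_upto k p X (y div 2) k)"
      then have "(b \<noteq> par_upto k p X (y div 2) k) = odd y" by auto
      then have "v = strand k g p X (y div 2) b (2 * k)"
        using y by (simp add: strand_def extra_def)
      then show ?thesis using y by (intro in_image) auto
    qed
  qed
  have "card (?f ` ?A) \<le> card ?A" by (rule card_image_le) simp
  moreover have "card ?A \<le> card (?f ` ?A)" by (rule card_mono) (use surj in auto)
  ultimately have c: "card (?f ` ?A) = card ?A" by simp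
  then have "inj_on ?f ?A" by (intro eq_card_imp_inj_on) auto
  moreover have "?A = ?f ` ?A" by (rule card_subset_eq) (use surj c in auto)
  ultimately show ?thesis by simp
qed

section \<open>The cycles formed by the streams\<close>

lemma cyc_succ_interior:
  assumes "Suc r < L" shows "cyc_succ (c * L) (s * L + r) = s * L + Suc r"
proof -
  have "\<not> L dvd s * L + Suc r" using assms by (metis dvd_add_right_iff dvd_triv_right nat_dvd_not_less zero_less_Suc)
  \<comment> \<open>The factor \<open>c\<close> is 1 for cycles of one strand and 2 for cycles of
    two strands.\<close>
  then have "\<not> c * L dvd s * L + Suc r" by (metis dvd_mult_right)
  then show ?thesis by (simp add: cyc_succ_def)
qed

lemma cyc_succ_wrap: "Suc q = L * Suc s \<Longrightarrow> cyc_succ L q = L * s"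
  by (simp only: cyc_succ_def dvd_triv_left if_True) simp

text \<open>From an even position a strand passes a gadget, along an edge of \<open>alice\<close>
  that changes sides exactly if the index lies in \<open>X\<close>. From an odd position it goes on
  to the next gadget or to the closing vertex, along an edge of \<open>bob\<close> that keeps the
  side.\<close>

lemma strand_edge_mem:
  assumes "j < g" "r < 2 * k" "p permutes {..<k * g}"
  shows "{strand k g p X j b r, strand k g p X j b (Suc r)} \<in> set (alice (k * g) X @ bob k g p W)"
proof -
  define i where "i = r div 2"
  have i: "i < k" using assms by (simp add: i_def)
  have pi: "p (j * k + i) < k * g"
  proof -
    have "j * k + i < (j + 1) * k" using i by simp
    also have "\<dots> \<le> g * k" using assms by (intro mult_le_mono1) simp
    finally show ?thesis using assms(3) by (metis lessThan_iff mult.commute permutes_in_image)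
  qed
  show ?thesis
  proof (cases "even r")
    case True
    then have r: "r = 2 * i" by (simp add: i_def)
    let ?a = "b \<noteq> par_upto k p X j i"
    have "{strand k g p X j b r, strand k g p X j b (Suc r)} =
        {upper (p (j * k + i)) ?a, lower (p (j * k + i)) (?a \<noteq> (p (j * k + i) \<in> X))}"
    proof -
      have "(b \<noteq> par_upto k p X j (Suc i)) = (?a \<noteq> (p (j * k + i) \<in> X))" by (auto simp: par_upto_Suc)
      moreover have "Suc r \<noteq> 2 * k" "Suc r div 2 = i" "odd (Suc r)" unfolding r by (presburger, simp, simp)
      ultimately show ?thesis unfolding strand_def using i r by simp
    qed
    moreover have "(p (j * k + i), ?a) \<in> set (List.product [0..<k * g] [False, True])" using pi by auto
    ultimately show ?thesis unfolding alice_def set_append set_map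
      by (intro UnI1 image_eqI[where x = "(p (j * k + i), ?a)"]) auto
  next
    case False
    then have r: "r = 2 * i + 1" by (simp add: i_def)
    let ?a = "b \<noteq> par_upto k p X j (Suc i)"
    have eq: "{strand k g p X j b r, strand k g p X j b (Suc r)} =
        {lower (p (j * k + i)) ?a, if Suc i < k then upper (p (j * k + Suc i)) ?a else extra (k * g) j ?a}"
    proof -
      have "r \<noteq> 2 * k" "r div 2 = i" "odd r" unfolding r by (presburger, simp, simp)
      then have 1: "strand k g p X j b r = lower (p (j * k + i)) ?a" by (simp add: strand_def)
      have 2: "strand k g p X j b (Suc r) = (if Suc i < k then upper (p (j * k + Suc i)) ?a else extra (k * g) j ?a)"
      proof (cases "Suc i < k")
        case True
        then have "Suc r \<noteq> 2 * k" "Suc r div 2 = Suc i" "even (Suc r)" using r by auto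
        then show ?thesis using True by (simp add: strand_def)
      next
        case False
        then have "Suc i = k" using i by simp
        moreover have "Suc r = 2 * Suc i" using r by simp
        ultimately show ?thesis by (simp add: strand_def)
      qed
      show ?thesis unfolding 1 2 ..
    qed
    have "((j, i), ?a) \<in> set (List.product (List.product [0..<g] [0..<k]) [False, True])" using assms i by auto
    then show ?thesis unfolding eq bob_def set_append set_map by (intro UnI2 UnI1 image_eqI[where x = "((j, i), ?a)"]) auto
  qed
qed

text \<open>Strand \<open>b\<close> ends on side \<open>b \<noteq> par_upto k p X j k\<close>, and a
  twist changes sides once more. So \<open>W = parset k g p X\<close> gives \<open>b' = b\<close>,
  and its complement gives \<open>b' = (\<not> b)\<close>.\<close>

lemma closing_edge_mem:
  assumes "j < g" "k > 0" "(j \<in> W) = (par_upto k p X j k \<noteq> (b \<noteq> b'))"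
  shows "{strand k g p X j b (2 * k), strand k g p X j b' 0} \<in> set (alice (k * g) X @ bob k g p W)"
proof -
  let ?a = "b \<noteq> par_upto k p X j k"
  have b': "b' = (?a \<noteq> (j \<in> W))" using assms by auto
  have eq: "{strand k g p X j b (2 * k), strand k g p X j b' 0} = {extra (k * g) j ?a, upper (p (j * k)) (?a \<noteq> (j \<in> W))}"
    unfolding strand_def using assms(2) b' by simp
  have "(j, ?a) \<in> set (List.product [0..<g] [False, True])" using assms by auto
  then show ?thesis unfolding eq bob_def set_append set_map by (intro UnI2 image_eqI[where x = "(j, ?a)"]) auto
qed

text \<open>The stream has as many entries as the cycles have edges, so one inclusion forces
  equality and leaves no room for repetitions.\<close>

lemma stream_cycles:
  assumes p: "p permutes {..<k * g}" and k: "k > 0" and L: "L * h = (4 * k + 2) * g" "L \<ge> 3"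
    and sub: "(`) (layout k g p X) ` cycles L h \<subseteq> set (alice (k * g) X @ bob k g p W)"
  shows "set (alice (k * g) X @ bob k g p W) = (`) (layout k g p X) ` cycles L h"
    and "distinct (alice (k * g) X @ bob k g p W)"
proof -
  let ?l = "alice (k * g) X @ bob k g p W" and ?E = "(`) (layout k g p X) ` cycles L h"
  have "card ?E = (4 * k + 2) * g" using card_image_cycles[OF L(2), of "layout k g p X" h] layout_bij[OF p k] L(1) by simp
  moreover have "length ?l = (4 * k + 2) * g" by (simp add: length_alice length_bob algebra_simps)
  moreover have "card ?E \<le> card (set ?l)" using sub by (intro card_mono) auto
  moreover have "card (set ?l) \<le> length ?l" by (rule card_length)
  ultimately have c: "card (set ?l) = length ?l" "card ?E = card (set ?l)" by linarith+
  show "distinct ?l" using c(1) by (rule card_distinct)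
  show "set ?l = ?E" using card_subset_eq[OF _ sub c(2)] by simp
qed

lemma yes_stream_contains_cycles:
  assumes p: "p permutes {..<k * g}" and k: "k > 0"
  shows "(`) (layout k g p X) ` cycles (4 * k + 2) g \<subseteq> set (alice (k * g) X @ bob k g p ({..<g} - parset k g p X))"
    (is "_ \<subseteq> ?S")
proof -
  let ?L = "2 * k + 1"
  have "layout k g p X ` {q, cyc_succ (4 * k + 2) q} \<in> ?S" if q: "q < (4 * k + 2) * g" for q
  proof -
    obtain j b r where jbr: "j < g" "r < ?L" and qe: "q = (2 * j + of_bool b) * ?L + r"
      using position_exists[OF q] by metis
    have L2: "4 * k + 2 = 2 * ?L" by simp
    show ?thesis
    proof (cases "r < 2 * k")
      case True
      then have s: "cyc_succ (4 * k + 2) q = (2 * j + of_bool b) * ?L + Suc r"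
        unfolding qe L2 by (intro cyc_succ_interior) simp
      have "layout k g p X q = strand k g p X j b r" unfolding qe by (rule layout_strand) (rule jbr)
      moreover have "layout k g p X (cyc_succ (4 * k + 2) q) = strand k g p X j b (Suc r)"
        unfolding s by (rule layout_strand) (use True in simp)
      ultimately show ?thesis using strand_edge_mem[OF jbr(1) True p, of X b] by simp
    next
      case False
      then have r: "r = 2 * k" using jbr by simp
      \<comment> \<open>The end of strand \<open>False\<close> is followed directly by the start of
        strand \<open>True\<close>, whose end wraps around to the start of strand
        \<open>False\<close>.\<close>
      have s: "cyc_succ (4 * k + 2) q = (2 * j + of_bool (\<not> b)) * ?L + 0"
      proof (cases b)
        case True
        have "Suc q = 2 * ?L * Suc j" unfolding qe r using True by (simp add: algebra_simps)
        then show ?thesis using True unfolding L2 by (simp only: cyc_succ_wrap) (simp add: algebra_simps)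
      next
        case F: False
        have e: "Suc q = 2 * ?L * j + ?L" unfolding qe r using F by (simp add: algebra_simps)
        have "\<not> 2 * ?L dvd Suc q" unfolding e
          by (metis dvd_add_right_iff dvd_triv_left nat_dvd_not_less less_add_same_cancel2 mult_2 zero_less_Suc Suc_eq_plus1)
        then show ?thesis using F e unfolding cyc_succ_def L2 by (simp add: algebra_simps)
      qed
      have "{strand k g p X j b (2 * k), strand k g p X j (\<not> b) 0} \<in> ?S"
        by (rule closing_edge_mem) (use jbr k mem_parset_iff[OF jbr(1), of k p X] in auto)
      moreover have "layout k g p X q = strand k g p X j b (2 * k)" unfolding qe r by (rule layout_strand) simp
      moreover have "layout k g p X (cyc_succ (4 * k + 2) q) = strand k g p X j (\<not> b) 0" unfolding s by (rule layout_strand) simp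
      ultimately show ?thesis by simp
    qed
  qed
  then show ?thesis unfolding cycles_def image_subset_iff by blast
qed

lemma no_stream_contains_cycles:
  assumes p: "p permutes {..<k * g}" and k: "k > 0"
  shows "(`) (layout k g p X) ` cycles (2 * k + 1) (2 * g) \<subseteq> set (alice (k * g) X @ bob k g p (parset k g p X))"
    (is "_ \<subseteq> ?S")
proof -
  let ?L = "2 * k + 1"
  have "layout k g p X ` {q, cyc_succ ?L q} \<in> ?S" if q: "q < ?L * (2 * g)" for q
  proof -
    have "q < (4 * k + 2) * g" using q by (simp add: algebra_simps)
    then obtain j b r where jbr: "j < g" "r < ?L" and qe: "q = (2 * j + of_bool b) * ?L + r"
      using position_exists by metis
    show ?thesis
    proof (cases "r < 2 * k")
      case True
      then have "cyc_succ (1 * ?L) q = (2 * j + of_bool b) * ?L + Suc r"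
        unfolding qe by (intro cyc_succ_interior) simp
      then have s: "cyc_succ ?L q = (2 * j + of_bool b) * ?L + Suc r" by simp
      have "layout k g p X q = strand k g p X j b r" unfolding qe by (rule layout_strand) (rule jbr)
      moreover have "layout k g p X (cyc_succ ?L q) = strand k g p X j b (Suc r)"
        unfolding s by (rule layout_strand) (use True in simp)
      ultimately show ?thesis using strand_edge_mem[OF jbr(1) True p, of X b] by simp
    next
      case False
      then have r: "r = 2 * k" using jbr by simp
      have "Suc q = ?L * Suc (2 * j + of_bool b)" unfolding qe r by (simp add: algebra_simps)
      then have s: "cyc_succ ?L q = (2 * j + of_bool b) * ?L + 0" by (simp only: cyc_succ_wrap mult.commute add_0_right)
      have "{strand k g p X j b (2 * k), strand k g p X j b 0} \<in> ?S"
        by (rule closing_edge_mem) (use jbr k mem_parset_iff[OF jbr(1), of k p X] in auto)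
      moreover have "layout k g p X q = strand k g p X j b (2 * k)" unfolding qe r by (rule layout_strand) simp
      moreover have "layout k g p X (cyc_succ ?L q) = strand k g p X j b 0" unfolding s by (rule layout_strand) simp
      ultimately show ?thesis by simp
    qed
  qed
  then show ?thesis unfolding cycles_def image_subset_iff by blast
qed

lemma yes_stream:
  assumes p: "p permutes {..<k * g}" and k: "k > 0" and M: "(4 * k + 2) * g \<le> M"
  shows "alice (k * g) X @ bob k g p ({..<g} - parset k g p X) \<in> yes_streams M"
proof -
  note s = stream_cycles[OF p k _ _ yes_stream_contains_cycles[OF p k]]
  have L: "4 * k + 2 \<ge> 3" "even (4 * k + 2)" using k by auto
  note lay = conjunct1[OF layout_bij[OF p k, of X]]
  have V: "layout k g p X ` {..<(4 * k + 2) * g} \<subseteq> {..<M}" using layout_bij[OF p k, of X] M by auto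
  show ?thesis unfolding yes_streams_def planar_streams_def
    using s L simple_graph_image_cycles[OF L(1) lay V] planar_image_cycles[OF L(1) lay V] bipartite_even_cycles[OF L lay V]
    by auto
qed

text \<open>One edge must go from each of \<open>2 * g\<close> odd cycles of length
  \<open>2 * k + 1\<close>, so a fraction \<open>1 / (2 * k + 1)\<close> of the edges, more than the
  required \<open>1 / (2 * k + 2)\<close>. For \<open>k = 2 * t\<close> the latter is
  \<open>1 / (4 * t + 2)\<close>.\<close>

lemma no_stream:
  assumes p: "p permutes {..<k * g}" and k: "k > 0" and g: "g > 0" and M: "(4 * k + 2) * g \<le> M"
  shows "alice (k * g) X @ bob k g p (parset k g p X) \<in> no_streams (1 / (2 * real k + 2)) M"
proof -
  have Lh: "(2 * k + 1) * (2 * g) = (4 * k + 2) * g" by simp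
  have L: "2 * k + 1 \<ge> 3" "odd (2 * k + 1)" using k by auto
  note s = stream_cycles[OF p k Lh L(1) no_stream_contains_cycles[OF p k]]
  note lay = conjunct1[OF layout_bij[OF p k, of X], folded Lh]
  have V: "layout k g p X ` {..<(2 * k + 1) * (2 * g)} \<subseteq> {..<M}"
    unfolding Lh using layout_bij[OF p k, of X] M by auto
  let ?E = "(`) (layout k g p X) ` cycles (2 * k + 1) (2 * g)"
  have card: "card ?E = (2 * k + 1) * (2 * g)" by (rule card_image_cycles[OF L(1) lay])
  have del: "2 * g \<le> card F" if "F \<subseteq> ?E" "bipartite {..<M} (?E - F)" for F
    using odd_cycles_far[OF L lay that] .
  have "far_from_bipartite (1 / (2 * real k + 2)) {..<M} ?E"
    unfolding far_from_bipartite_def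
  proof (intro allI impI)
    fix F assume F: "F \<subseteq> ?E" "bipartite {..<M} (?E - F)"
    have "1 / (2 * real k + 2) * real (card ?E) \<le> real (2 * g)" unfolding card by (simp add: field_simps)
    also have "\<dots> \<le> real (card F)" using del[OF F] by (simp only: of_nat_le_iff)
    finally show "1 / (2 * real k + 2) * real (card ?E) \<le> real (card F)" .
  qed
  moreover have "\<not> bipartite {..<M} ?E" using del[of "{}"] g by auto
  ultimately show ?thesis unfolding no_streams_def planar_streams_def
    using s simple_graph_image_cycles[OF L(1) lay V] planar_image_cycles[OF L(1) lay V] by auto
qed

section \<open>The space bound\<close>

definition continue :: "stream_alg \<Rightarrow> bool list \<Rightarrow> nat set list \<Rightarrow> bool pmf" where
  "continue A m \<tau> = bind_pmf (foldl (\<lambda>D e. bind_pmf D (\<lambda>m. update A m e)) (return_pmf m) \<tau>) (answer A)"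

text \<open>The Markov property: a run from a distribution is the mixture of the runs from its
  states. So the memory at a cut acts as a one-way message.\<close>

lemma foldl_bind_pmf:
  "foldl (\<lambda>D e. bind_pmf D (\<lambda>m. u m e)) D \<tau> =
   bind_pmf D (\<lambda>m. foldl (\<lambda>D e. bind_pmf D (\<lambda>m. u m e)) (return_pmf m) \<tau>)"
proof (induction \<tau> arbitrary: D)
  case Nil
  then show ?case by (simp add: bind_return_pmf')
next
  case (Cons e \<tau>)
  let ?f = "foldl (\<lambda>D e. bind_pmf D (\<lambda>m. u m e))"
  have "?f D (e # \<tau>) = bind_pmf (bind_pmf D (\<lambda>m. u m e)) (\<lambda>m. ?f (return_pmf m) \<tau>)"
    by (simp only: foldl_Cons) (rule Cons.IH)
  also have "\<dots> = bind_pmf D (\<lambda>m. bind_pmf (u m e) (\<lambda>m. ?f (return_pmf m) \<tau>))" by (rule bind_assoc_pmf)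
  also have "\<dots> = bind_pmf D (\<lambda>m. ?f (u m e) \<tau>)" by (simp only: Cons.IH[symmetric])
  finally show ?case by (simp add: bind_return_pmf)
qed

lemma outcome_append: "outcome A (\<sigma> @ \<tau>) = bind_pmf (run A \<sigma>) (\<lambda>m. continue A m \<tau>)"
proof -
  have "run A (\<sigma> @ \<tau>) = bind_pmf (run A \<sigma>) (\<lambda>m. foldl (\<lambda>D e. bind_pmf D (\<lambda>m. update A m e)) (return_pmf m) \<tau>)"
    unfolding run_def foldl_append by (rule foldl_bind_pmf)
  then show ?thesis by (simp add: outcome_def continue_def bind_assoc_pmf)
qed

lemma pmf_bind_finite:
  assumes "finite M" "set_pmf D \<subseteq> M"
  shows "pmf (bind_pmf D Q) x = (\<Sum>m\<in>M. pmf D m * pmf (Q m) x)"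
  unfolding pmf_bind using assms by (subst integral_measure_pmf[of M]) (auto simp: set_pmf_iff)

lemma card_short_bool_lists:
  "finite {m :: bool list. length m \<le> s}" "card {m :: bool list. length m \<le> s} \<le> 2 ^ (s + 1)"
proof -
  have eq: "{m :: bool list. length m \<le> s} = {m. set m \<subseteq> UNIV \<and> length m \<le> s}" by auto
  show "finite {m :: bool list. length m \<le> s}" unfolding eq by (rule finite_lists_length_le) simp
  have "card {m :: bool list. length m \<le> s} = (\<Sum>i\<le>s. 2 ^ i)"
    unfolding eq by (subst card_lists_length_le) auto
  also have "\<dots> \<le> 2 ^ (s + 1)" by (induction s) auto
  finally show "card {m :: bool list. length m \<le> s} \<le> 2 ^ (s + 1)" .
qed

text \<open>The message is the memory after \<open>alice\<close>. For every \<open>p\<close> and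
  \<open>X\<close> the probabilities of answering \<open>True\<close> differ by at least
  \<open>2 * P - 1\<close> between the two values of \<open>W\<close>; this is averaged over
  \<open>p\<close> and \<open>X\<close>. The threshold \<open>s'\<close> for heavy messages is kept
  apart from \<open>s\<close>, so that a larger \<open>s'\<close> makes all light messages together
  negligible.\<close>

lemma advantage_stream_alg:
  fixes t g J s s' M :: nat and \<theta> P :: real
  assumes pos: "t > 0" "g > 0" "0 < \<theta>" "\<theta> \<le> 1" and g: "even g" and Jg: "2 * J \<le> g"
    and cond: "(g / \<theta>) * (4 * J / g) ^ t \<le> 1 / 2" and sJ: "s' \<le> J"
    and M: "(8 * t + 2) * g \<le> M"
    and dist: "distinguishes P A (1 / (4 * real t + 2)) M"
    and space: "uses_space A (yes_streams M \<union> no_streams (1 / (4 * real t + 2)) M) s"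
  shows "2 * P - 1 \<le> 2 ^ (s + 1) / 2 ^ s' + 2 * sqrt (8 * \<theta> + 2 ^ s' / 2 ^ J)"
proof -
  define k where "k = 2 * t"
  define N where "N = k * g"
  define S where "S = {m :: bool list. length m \<le> s}"
  define f where "f m X = pmf (run A (alice N X)) m" for m X
  define B where "B m p W = pmf (continue A m (bob k g p W)) True" for m p W
  define yes where "yes p X = bob k g p ({..<g} - parset k g p X)" for p X
  define no where "no p X = bob k g p (parset k g p X)" for p X
  have k: "k > 0" using pos by (simp add: k_def)
  have M': "(4 * k + 2) * g \<le> M" using M by (simp add: k_def)
  have \<delta>: "1 / (4 * real t + 2) = 1 / (2 * real k + 2)" by (simp add: k_def)
  have Y: "alice N X @ yes p X \<in> yes_streams M" if "p permutes {..<N}" for p X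
    unfolding N_def yes_def using that by (intro yes_stream k M') (simp add: N_def)
  have No: "alice N X @ no p X \<in> no_streams (1 / (4 * real t + 2)) M" if "p permutes {..<N}" for p X
    unfolding N_def no_def \<delta> using that by (intro no_stream k M' pos) (simp add: N_def)
  have finS: "finite S" "card S \<le> 2 ^ (s + 1)" unfolding S_def by (rule card_short_bool_lists)+
  have run: "set_pmf (run A (alice N X)) \<subseteq> S" for X
  proof
    fix m assume m: "m \<in> set_pmf (run A (alice N X))"
    \<comment> \<open>The space bound speaks of prefixes of legal streams, so the first part is
      completed to one, here with the identity as permutation.\<close>
    let ?\<sigma> = "alice N X @ yes id X"
    have "?\<sigma> \<in> yes_streams M" by (intro Y permutes_id)
    then have "\<forall>i\<le>length ?\<sigma>. \<forall>m\<in>set_pmf (run A (take i ?\<sigma>)). length m \<le> s"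
      using space unfolding uses_space_def by blast
    from this[rule_format, of "length (alice N X)"]
    have "\<forall>m\<in>set_pmf (run A (alice N X)). length m \<le> s" by simp
    then show "m \<in> S" using m by (simp add: S_def)
  qed
  have adv: "2 * P - 1 \<le> (\<Sum>m\<in>S. f m X * (B m p ({..<g} - parset k g p X) - B m p (parset k g p X)))"
    if p: "p permutes {..<N}" for p X
  proof -
    have "P \<le> pmf (outcome A (alice N X @ yes p X)) True" using dist Y[OF p] unfolding distinguishes_def by blast
    moreover have "P \<le> pmf (outcome A (alice N X @ no p X)) False" using dist No[OF p] unfolding distinguishes_def by blast
    moreover have "pmf D False = 1 - pmf D True" for D :: "bool pmf" by (rule pmf_False_conv_True)
    moreover have "pmf (outcome A (alice N X @ bob k g p W)) True = (\<Sum>m\<in>S. f m X * B m p W)" for W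
      unfolding outcome_append f_def B_def by (rule pmf_bind_finite[OF finS(1) run])
    ultimately show ?thesis unfolding yes_def no_def by (simp add: right_diff_distrib sum_subtractf)
  qed
  let ?P = "{p. p permutes {..<N}}"
  have "(2 * P - 1) * (fact N * 2 ^ N) = (\<Sum>p\<in>?P. \<Sum>X\<in>Pow {..<N}. 2 * P - 1)"
    by (simp add: card_permutations card_Pow)
  also have "\<dots> \<le> (\<Sum>p\<in>?P. \<Sum>X\<in>Pow {..<N}. \<Sum>m\<in>S. f m X * (B m p ({..<g} - parset k g p X) - B m p (parset k g p X)))"
    by (intro sum_mono adv) simp
  also have "\<dots> = (\<Sum>m\<in>S. \<Sum>p\<in>?P. \<Sum>X\<in>Pow {..<N}. f m X * (B m p ({..<g} - parset k g p X) - B m p (parset k g p X)))"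
    by (subst sum.swap[of _ S], subst sum.swap[of _ S], rule refl)
  also have "\<dots> \<le> (card S / 2 ^ s' + 2 * sqrt (8 * \<theta> + 2 ^ s' / 2 ^ J)) * fact N * 2 ^ N"
    unfolding N_def k_def
  proof (rule advantage_protocol)
    show "0 \<le> f m X" "f m X \<le> 1" "0 \<le> B m p W" "B m p W \<le> 1" for m X p W by (simp_all add: f_def B_def pmf_le_1)
    show "(\<Sum>m\<in>S. f m X) = 1" for X unfolding f_def by (rule sum_pmf_eq_1[OF finS(1) run])
  qed (use pos g Jg cond sJ finS in auto)
  finally have "(2 * P - 1) * (fact N * 2 ^ N) \<le> (card S / 2 ^ s' + 2 * sqrt (8 * \<theta> + 2 ^ s' / 2 ^ J)) * (fact N * 2 ^ N)"
    by (simp add: mult.assoc)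
  then have "2 * P - 1 \<le> card S / 2 ^ s' + 2 * sqrt (8 * \<theta> + 2 ^ s' / 2 ^ J)"
    by (rule mult_right_le_imp_le) simp
  moreover have "card S / 2 ^ s' \<le> 2 ^ (s + 1) / 2 ^ s'"
  proof (rule divide_right_mono)
    show "real (card S) \<le> 2 ^ (s + 1)" using finS(2) by (metis of_nat_le_iff of_nat_numeral of_nat_power)
  qed simp
  ultimately show ?thesis by linarith
qed

text \<open>Without memory all streams have the same output distribution. This settles
  \<open>s = 0\<close>, where additive constants cannot be absorbed into a multiple of
  \<open>s\<close>.\<close>

lemma no_space_indistinguishable:
  assumes "P > 1 / 2" "distinguishes P A \<delta> M" "uses_space A (yes_streams M \<union> no_streams \<delta> M) 0"
    and "\<sigma> \<in> yes_streams M" "\<tau> \<in> no_streams \<delta> M"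
  shows False
proof -
  have "outcome A \<rho> = answer A []" if "\<rho> \<in> yes_streams M \<union> no_streams \<delta> M" for \<rho>
  proof -
    have "\<forall>m\<in>set_pmf (run A (take (length \<rho>) \<rho>)). length m \<le> 0"
      using assms(3) that unfolding uses_space_def by blast
    then have "set_pmf (run A \<rho>) \<subseteq> {[]}" by auto
    then have "run A \<rho> = return_pmf []" by (simp add: set_pmf_subset_singleton)
    then show ?thesis by (simp add: outcome_def bind_return_pmf)
  qed
  then have "P \<le> pmf (answer A []) True" "P \<le> pmf (answer A []) False"
    using assms unfolding distinguishes_def by force+
  then show False using assms(1) pmf_False_conv_True[of "answer A []"] by simp
qed

text \<open>The parameters are \<open>s' = s + K\<close>, \<open>J = s + 2 * K\<close> and
  \<open>\<theta> = \<eta>\<^sup>2 / 512\<close>. Light messages then cost at most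
  \<open>\<eta> / 32\<close> and heavy ones at most \<open>2 * (\<eta> / 5)\<close>.\<close>

lemma small_advantage:
  fixes \<eta> :: real
  assumes "0 < \<eta>" "\<eta> \<le> 1" and K: "64 / \<eta>\<^sup>2 \<le> 2 ^ K"
  shows "2 ^ (s + 1) / 2 ^ (s + K) + 2 * sqrt (8 * (\<eta>\<^sup>2 / 512) + 2 ^ (s + K) / 2 ^ (s + 2 * K)) < \<eta>"
proof -
  have K': "1 / 2 ^ K \<le> \<eta>\<^sup>2 / 64" using K assms by (simp add: field_simps)
  have "2 ^ (s + 1) / 2 ^ (s + K) = 2 * (1 / 2 ^ K :: real)" by (simp add: power_add)
  also have "\<dots> \<le> \<eta>\<^sup>2 / 32" using K' by simp
  also have "\<dots> \<le> \<eta> / 32" using assms by (simp add: power2_eq_square mult_left_le)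
  finally have 1: "2 ^ (s + 1) / 2 ^ (s + K) \<le> \<eta> / 32" .
  have "2 ^ (s + K) / 2 ^ (s + 2 * K) = (1 / 2 ^ K :: real)" by (simp add: power_add mult_2)
  then have "8 * (\<eta>\<^sup>2 / 512) + 2 ^ (s + K) / 2 ^ (s + 2 * K) \<le> \<eta>\<^sup>2 / 64 + \<eta>\<^sup>2 / 64"
    using K' by simp
  also have "\<dots> \<le> (\<eta> / 5)\<^sup>2" by (simp add: power_divide)
  finally have "sqrt (8 * (\<eta>\<^sup>2 / 512) + 2 ^ (s + K) / 2 ^ (s + 2 * K)) \<le> \<eta> / 5" using assms by (intro real_le_lsqrt) auto
  then show ?thesis using 1 assms by linarith
qed

text \<open>Cleared of denominators, the claim is
  \<open>(4 * J) ^ t \<le> \<theta> / 2 * g ^ (t - 1)\<close>. As \<open>J\<close> is at most linear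
  in \<open>s\<close> and \<open>g\<close> at least linear in \<open>n\<close>, it holds for
  \<open>s\<close> up to order \<open>n powr (1 - 1 / t)\<close>; this is the source of the
  exponent.\<close>

lemma space_condition:
  fixes t n g J R s :: nat and \<theta> :: real
  assumes "t > 0" "n > 0" "g > 0" "R > 0" and n: "n \<le> (4 * t + 1) * g" and J: "J \<le> R * s" and \<theta>: "0 < \<theta>" "\<theta> \<le> 1"
    and s: "s \<le> \<theta> / (8 * real R * (4 * real t + 1)) * real n powr (1 - 1 / t)"
  shows "(g / \<theta>) * (4 * J / g) ^ t \<le> 1 / 2"
proof -
  obtain u where t: "t = Suc u" using assms(1) by (cases t) auto
  define d where "d = 4 * real t + 1"
  have d: "d \<ge> 1" by (simp add: d_def)
  have x: "(real n powr (1 - 1 / t)) ^ t = real n ^ u"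
  proof -
    have "(real n powr (1 - 1 / t)) ^ t = real n powr ((1 - 1 / t) * t)" using assms by (simp add: powr_powr flip: powr_realpow)
    also have "(1 - 1 / t) * t = real u" using assms by (simp add: t field_simps)
    finally show ?thesis using assms by (simp add: powr_realpow)
  qed
  have "4 * real J \<le> 4 * (real R * real s)" using J by (metis mult_left_mono of_nat_le_iff of_nat_mult zero_le_numeral)
  also have "\<dots> \<le> 4 * (real R * (\<theta> / (8 * real R * (4 * real t + 1)) * real n powr (1 - 1 / t)))"
    using s by (intro mult_left_mono) auto
  also have "\<dots> = \<theta> / 2 / d * real n powr (1 - 1 / t)"
  proof -
    have "4 * (real R * (\<theta> / (8 * real R * d) * y)) = \<theta> / 2 / d * y" for y
      using assms(4) d by (simp add: field_simps)
    then show ?thesis unfolding d_def .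
  qed
  finally have "(4 * real J) ^ t \<le> (\<theta> / 2 / d * real n powr (1 - 1 / t)) ^ t" by (intro power_mono) auto
  also have "\<dots> = (\<theta> / 2) ^ t / d ^ t * real n ^ u" by (simp only: power_mult_distrib power_divide x)
  also have "\<dots> \<le> \<theta> / 2 / d ^ u * (d * g) ^ u"
  proof (intro mult_mono frac_le power_mono)
    show "(\<theta> / 2) ^ t \<le> \<theta> / 2" using \<theta> power_decreasing[of 1 t "\<theta> / 2"] assms(1) by simp
    show "d ^ u \<le> d ^ t" using d by (simp add: t)
    show "real n \<le> d * g" using n unfolding d_def
      by (metis (mono_tags, lifting) of_nat_1 of_nat_add of_nat_le_iff of_nat_mult of_nat_numeral)
  qed (use \<theta> d in auto)
  also have "\<dots> = \<theta> / 2 * g ^ u" using d by (simp add: power_mult_distrib)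
  finally have "(4 * real J) ^ t \<le> \<theta> / 2 * g ^ u" .
  then show ?thesis using assms \<theta> by (simp add: t power_divide field_simps)
qed

theorem theorem5p7:
  fixes t :: nat and p :: real
  assumes "t \<ge> 1" and "odd t" and "p > 1 / 2"
  shows "\<exists>c>0. \<forall>\<^sub>F n in sequentially. \<forall>(A :: stream_alg) (s :: nat).
           distinguishes p A (1 / (4 * real t + 2)) (4 * n + 2) \<and>
           uses_space A (yes_streams (4 * n + 2) \<union> no_streams (1 / (4 * real t + 2)) (4 * n + 2)) s
           \<longrightarrow> c * real n powr (1 - 1 / real t) \<le> real s"
proof -
  \<comment> \<open>The cap at 1 makes \<open>\<eta>\<^sup>2 \<le> \<eta>\<close> available for
    every \<open>p\<close>.\<close>
  define \<eta> where "\<eta> = min 1 (2 * p - 1)"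
  define \<theta> where "\<theta> = \<eta>\<^sup>2 / 512"
  have \<eta>: "0 < \<eta>" "\<eta> \<le> 1" "\<eta> \<le> 2 * p - 1" using assms by (auto simp: \<eta>_def)
  have \<theta>: "0 < \<theta>" "\<theta> \<le> 1" using \<eta> power_le_one[of \<eta> 2] by (auto simp: \<theta>_def)
  obtain K where K: "64 / \<eta>\<^sup>2 < 2 ^ K" using real_arch_pow[of 2 "64 / \<eta>\<^sup>2"] by auto
  define R where "R = 2 * K + 1"
  define c where "c = \<theta> / (8 * real R * (4 * real t + 1))"
  have "c * real n powr (1 - 1 / t) \<le> real s"
    if n: "n \<ge> 4 * t + 1" and dist: "distinguishes p A (1 / (4 * real t + 2)) (4 * n + 2)"
      and space: "uses_space A (yes_streams (4 * n + 2) \<union> no_streams (1 / (4 * real t + 2)) (4 * n + 2)) s" for n A s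
  proof (rule ccontr)
    assume "\<not> ?thesis"
    then have s: "real s \<le> c * real n powr (1 - 1 / t)" by simp
    \<comment> \<open>The construction takes \<open>(8 * t + 2) * g = 4 * (4 * t + 1) * q\<close>
      vertices, which fit into \<open>4 * n + 2\<close>. The number of blocks is made even for the
      bound on odd levels, and rounding down costs at most a factor 2 in
      \<open>n \<le> (4 * t + 1) * g\<close>.\<close>
    define q where "q = n div (4 * t + 1)"
    define g where "g = 2 * q"
    have q: "q \<ge> 1" using n div_le_mono[of "4 * t + 1" n "4 * t + 1"] by (simp add: q_def)
    have g: "g > 0" "even g" using q by (auto simp: g_def)
    have "(4 * t + 1) * q \<le> n" unfolding q_def by (rule times_div_less_eq_dividend)
    then have M: "(8 * t + 2) * g \<le> 4 * n + 2" by (simp add: g_def)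
    have "n < (4 * t + 1) * (q + 1)" unfolding q_def by (metis Suc_eq_plus1 add_gr_0 dividend_less_times_div less_numeral_extra(1) mult_Suc_right add.commute)
    also have "\<dots> \<le> (4 * t + 1) * g" using q by (intro mult_le_mono2) (simp add: g_def)
    finally have ng: "n \<le> (4 * t + 1) * g" by simp
    show False
    proof (cases "s = 0")
      case True
      let ?X = "{}" and ?\<pi> = "id :: nat \<Rightarrow> nat" and ?k = "2 * t"
      have \<pi>: "?\<pi> permutes {..<?k * g}" by (rule permutes_id)
      have "alice (?k * g) ?X @ bob ?k g ?\<pi> ({..<g} - parset ?k g ?\<pi> ?X) \<in> yes_streams (4 * n + 2)"
        using assms M by (intro yes_stream \<pi>) auto
      moreover have "alice (?k * g) ?X @ bob ?k g ?\<pi> (parset ?k g ?\<pi> ?X) \<in> no_streams (1 / (2 * real ?k + 2)) (4 * n + 2)"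
        using assms M g by (intro no_stream \<pi>) auto
      ultimately show False
        using no_space_indistinguishable[OF assms(3) dist space[unfolded True]] by simp
    next
      case False
      define J where "J = s + 2 * K"
      have "2 * K \<le> 2 * K * s" using False by simp
      then have J: "J \<le> R * s" by (simp add: J_def R_def)
      have cond: "(g / \<theta>) * (4 * J / g) ^ t \<le> 1 / 2"
        using assms(1) n g ng J \<theta> s by (intro space_condition[where R = R and n = n and s = s]) (auto simp: R_def c_def)
      \<comment> \<open>The size restriction \<open>2 * J \<le> g\<close> is a consequence of
        \<open>cond\<close>, because \<open>g / \<theta>\<close> is at least 1.\<close>
      have "4 * real J / g \<le> 1"
      proof (rule ccontr)
        assume "\<not> ?thesis"
        then have "1 \<le> (4 * real J / g) ^ t" by (intro one_le_power) simp
        moreover have "1 \<le> g / \<theta>" using g \<theta> by (simp add: field_simps)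
        ultimately have "1 * 1 \<le> (g / \<theta>) * (4 * J / g) ^ t" by (intro mult_mono) auto
        then show False using cond by linarith
      qed
      then have Jg: "2 * J \<le> g" using g by (simp add: field_simps)
      have "2 * p - 1 \<le> 2 ^ (s + 1) / 2 ^ (s + K) + 2 * sqrt (8 * \<theta> + 2 ^ (s + K) / 2 ^ J)"
        using assms(1) g \<theta> Jg cond M dist space by (intro advantage_stream_alg) (auto simp: J_def)
      also have "\<dots> < \<eta>" unfolding \<theta>_def J_def using \<eta> K by (intro small_advantage) auto
      finally show False using \<eta> by simp
    qed
  qed
  moreover have "c > 0" using \<theta> by (simp add: c_def R_def)
  ultimately show ?thesis unfolding eventually_sequentially by blast
qed

end
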